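(* There exists a universal constant $C\in(0,1]$ such that, for all integers $n\ge3$ and $k\ge2$, any $\rho$-estimator $\widehat s$ on $\mathscr F_k$ satisfies, for every density $s\in\mathscr L_\mu$, $$C\,\mathbb E_s\left[h^2(s,\widehat s)\right]\le\inf_{D\ge1}\left[\inf_{\overline s\in\mathscr F_k\cap\overline V(D)}h^2(s,\overline s)+\frac{k+D}n\log_+^3\left(\frac n{k+D}\right)\right],$$ where the infimum is over integers $D\ge1$.
   Context: Setting. $\mu$ is the Lebesgue measure on $\mathbb R$ and $\mathscr L_\mu$ is the set of probability densities on $\mathbb R$ with respect to $\mu$. The Hellinger distance is $h(t,u)=\left[\frac12\int(\sqrt t-\sqrt u)^2d\mu\right]^{1/2}$. One observes i.i.d. random variables $X_1,\dots,X_n$ ($n\ge3$) with density $s\in\mathscr L_\mu$; $\mathbb E_s$ is the expectation when the true density is $s$. $\log_+(x)=\max\{\log x,1\}$. $\mathcal J(k)$ is the set of partitions of $\mathbb R$ into $k$ open intervals: $\mathcal I=\{I_0,\dots,I_{k-1}\}$ with $I_j=(x_j,x_{j+1})$, $-\infty=x_0<x_1<\dots<x_{k-1}<x_k=+\infty$. For $k\ge2$, $\mathscr F_k$ is the set of densities $f\in\mathscr L_\mu$ for which there is $\mathcal I\in\mathcal J(k)$ such that $f$ is monotone on each open interval $I_j$ of $\mathcal I$. For an integer $D\ge1$, $\overline V(D)$ is the set of all densities of the form $\sum_{j=1}^Da_j\mathbf 1_{(x_j,x_{j+1}]}$ with $x_1<x_2<\dots<x_{D+1}$ real and $a_j\ge0$.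 $\rho$-estimators. Let $\psi(u)=\frac{u-1}{\sqrt{1+u^2}}$ for $u\in[0,+\infty)$ and $\psi(+\infty)=1$. For densities $t,t'$ put $$\mathbf T(\boldsymbol X,t,t')=\frac n2\left[h^2\left(t,\tfrac{t+t'}2\right)-h^2\left(t',\tfrac{t+t'}2\right)\right]+\frac1{\sqrt2}\sum_{i=1}^n\psi\left(\sqrt{\tfrac{t'}{t}(X_i)}\right),$$ with the conventions $0/0=1$ and $a/0=+\infty$ for $a>0$. For a model $\overline S\subset\mathscr L_\mu$ and an at most countable subset $S$ of $\overline S$ which is dense in $\overline S$ for the Hellinger distance, let $\boldsymbol\Upsilon(S,t)=\sup_{t'\in S}\mathbf T(\boldsymbol X,t,t')$. A $\rho$-estimator on $\overline S$ is any (measurable) element $\widehat s$ of the closure (for $h$) of $\{t\in S:\ \boldsymbol\Upsilon(S,t)\le\inf_{t'\in S}\boldsymbol\Upsilon(S,t')+35.7\}$. *)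

theory Defs
  imports "HOL-Probability.Probability"
begin

definition densities :: "(real \<Rightarrow> real) set" where
  "densities = {f \<in> borel_measurable borel.
     (\<forall>x. 0 \<le> f x) \<and> (\<integral>\<^sup>+x. ennreal (f x) \<partial>lborel) = 1}"

definition hellinger :: "(real \<Rightarrow> real) \<Rightarrow> (real \<Rightarrow> real) \<Rightarrow> real" where
  "hellinger t u = sqrt (1/2 * (\<integral>x. (sqrt (t x) - sqrt (u x))\<^sup>2 \<partial>lborel))"

definition log_plus :: "real \<Rightarrow> real" where
  "log_plus x = max (ln x) 1"

definition interval_partitions :: "nat \<Rightarrow> real set set set" where
  "interval_partitions k =
     {(\<lambda>j. einterval (x j) (x (Suc j))) ` {..<k} | x :: nat \<Rightarrow> ereal.
        x 0 = -\<infinity> \<and> x k = \<infinity> \<and> (\<forall>j<k. x j < x (Suc j))}"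

definition piecewise_monotone_densities :: "nat \<Rightarrow> (real \<Rightarrow> real) set" where
  "piecewise_monotone_densities k =
     {f \<in> densities. \<exists>P\<in>interval_partitions k. \<forall>I\<in>P. mono_on I f \<or> antimono_on I f}"

definition step_densities :: "nat \<Rightarrow> (real \<Rightarrow> real) set" where
  "step_densities D =
     {f \<in> densities. \<exists>(x :: nat \<Rightarrow> real) (a :: nat \<Rightarrow> real).
        (\<forall>j\<in>{1..D}. x j < x (Suc j) \<and> 0 \<le> a j) \<and>
        f = (\<lambda>y. \<Sum>j=1..D. a j * indicator {x j<..x (Suc j)} y)}"

(* Likelihood ratios live in [0, \<infinity>]. Division on ennreal is not used because it has 0 / 0 = 0. *)
definition ratio :: "real \<Rightarrow> real \<Rightarrow> ennreal" where
  "ratio a b = (if b = 0 then (if a = 0 then 1 else \<infinity>) else ennreal (a / b))"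

definition ennreal_sqrt :: "ennreal \<Rightarrow> ennreal" where
  "ennreal_sqrt u = (if u = \<infinity> then \<infinity> else ennreal (sqrt (enn2real u)))"

definition psi :: "ennreal \<Rightarrow> real" where
  "psi u = (if u = \<infinity> then 1 else (enn2real u - 1) / sqrt (1 + (enn2real u)\<^sup>2))"

definition rho_T :: "nat \<Rightarrow> (nat \<Rightarrow> real) \<Rightarrow> (real \<Rightarrow> real) \<Rightarrow> (real \<Rightarrow> real) \<Rightarrow> real" where
  "rho_T n X t t' =
     real n / 2 * ((hellinger t (\<lambda>x. (t x + t' x) / 2))\<^sup>2
                   - (hellinger t' (\<lambda>x. (t x + t' x) / 2))\<^sup>2)
     + 1 / sqrt 2 * (\<Sum>i=1..n. psi (ennreal_sqrt (ratio (t' (X i)) (t (X i)))))"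

(* The suprema and infima over a nonempty set of densities are those of bounded sets of reals:
   |rho_T n X t t'| \<le> n / 2 + n / sqrt 2 on densities. *)
definition rho_Upsilon :: "nat \<Rightarrow> (nat \<Rightarrow> real) \<Rightarrow> (real \<Rightarrow> real) set \<Rightarrow> (real \<Rightarrow> real) \<Rightarrow> real" where
  "rho_Upsilon n X S t = (SUP t'\<in>S. rho_T n X t t')"

definition rho_near_minimizers :: "nat \<Rightarrow> (nat \<Rightarrow> real) \<Rightarrow> (real \<Rightarrow> real) set \<Rightarrow> (real \<Rightarrow> real) set" where
  "rho_near_minimizers n X S =
     {t \<in> S. rho_Upsilon n X S t \<le> (INF t'\<in>S. rho_Upsilon n X S t') + 35.7}"

(* The Hellinger distance is only a pseudometric on functions (it vanishes on a.e. equal densities),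
   so closure, density and Borel sets are spelled out for it. *)
definition hellinger_closure :: "(real \<Rightarrow> real) set \<Rightarrow> (real \<Rightarrow> real) set" where
  "hellinger_closure A = {t \<in> densities. \<forall>e>0. \<exists>u\<in>A. hellinger t u < e}"

definition hellinger_open :: "(real \<Rightarrow> real) set \<Rightarrow> bool" where
  "hellinger_open U \<longleftrightarrow>
     U \<subseteq> densities \<and> (\<forall>t\<in>U. \<exists>e>0. \<forall>u\<in>densities. hellinger t u < e \<longrightarrow> u \<in> U)"

definition hellinger_borel :: "(real \<Rightarrow> real) measure" where
  "hellinger_borel = sigma densities {U. hellinger_open U}"

definition rho_estimator ::
    "nat \<Rightarrow> (real \<Rightarrow> real) set \<Rightarrow> ((nat \<Rightarrow> real) \<Rightarrow> (real \<Rightarrow> real)) \<Rightarrow> bool" where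
  "rho_estimator n M shat \<longleftrightarrow>
     shat \<in> (\<Pi>\<^sub>M i\<in>{1..n}. borel) \<rightarrow>\<^sub>M hellinger_borel \<and>
     (\<exists>S. countable S \<and> S \<subseteq> M \<and> M \<subseteq> hellinger_closure S \<and>
        (\<forall>X\<in>space (\<Pi>\<^sub>M i\<in>{1..n}. borel). shat X \<in> hellinger_closure (rho_near_minimizers n X S)))"

definition sample_measure :: "nat \<Rightarrow> (real \<Rightarrow> real) \<Rightarrow> (nat \<Rightarrow> real) measure" where
  "sample_measure n s = (\<Pi>\<^sub>M i\<in>{1..n}. density lborel (\<lambda>x. ennreal (s x)))"

end

theory Submission
  imports Defs
begin

text \<open>
  Fix \<open>f\<close> in the model which is also a step function with \<open>D\<close> pieces. For every \<open>u\<close> in the model the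
  level sets of \<open>psi (sqrt (u / f))\<close> are unions of \<open>O(k + D)\<close> intervals. Unions of intervals are
  bracketed by unions of quantile cells of the law of the sample; there are few of these, so a
  Chernoff bound and a union bound give a deviation of order \<open>sqrt (n P(A) y) + y\<close>, with
  \<open>y \<sim> (k + D) log (n / (k + D))\<close>, simultaneously for all such sets \<open>A\<close>. Summing over the levels
  \<open>j / M\<close> with weights proportional to \<open>j / M\<close> turns this into a deviation of at most
  \<open>\<delta> n E(psi^2) + O(y log (n / (k + D)) / \<delta>)\<close> for the statistic \<open>T\<close>. As \<open>E(psi^2)\<close> is controlled by
  \<open>h^2(s, f) + h^2(s, u)\<close> and \<open>E T(f, u) / n \<le> (1 + 1/sqrt 2) h^2(s, f) - (1 - 1/sqrt 2) h^2(s, u)\<close>,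
  comparing an approximate minimizer with \<open>f\<close> gives the bound on an event of probability at least
  \<open>1 - 2 (k + D) / n\<close>.
\<close>

text \<open>Two obstacles shape the argument. The negative coefficient of h^2(s,u) in the mean of T
  must survive the fluctuations uniformly in \<open>u\<close>. So the deviation of each level set is
  measured by its own standard deviation, and \<open>1/60\<close> for delta turns the variance
  constant 6 into 1/10, well below 1 - 1/sqrt 2. Moreover \<open>f\<close> need not belong to the
  countable set over which the estimator is computed, and T is discontinuous in its first argument
  at zeros of that density. Hence \<open>f\<close> is replaced by a nearby member of that set, at
  the price of counting the observations in \<open>{f = 0}\<close>. There are as many quantile cells
  as observations, each of mass at most 1/n, so a bracket changes the expected count by at most the
  number of cuts, which is below y. One logarithm comes from the union bound and one from the
  harmonic sum over the levels: the argument yields log^2, relaxed to log^3 at the end. For k + D >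
  n the claim only says h^2 <= 1.\<close>

section \<open>The statistic T and the Hellinger distance\<close>

text \<open>The conventions for ratios are built in, since \<open>x / 0 = 0\<close> gives \<open>rho_phi 0 0 = 0 = psi 1\<close>.\<close>
definition rho_phi :: "real \<Rightarrow> real \<Rightarrow> real" where
  "rho_phi a b = (sqrt b - sqrt a) / sqrt (a + b)"

lemma psi_ratio:
  assumes "0 \<le> a" "0 \<le> b"
  shows "psi (ennreal_sqrt (ratio b a)) = rho_phi a b"
proof (cases "a = 0")
  case True
  then show ?thesis using assms
    by (auto simp: psi_def ennreal_sqrt_def ratio_def rho_phi_def)
next
  case False
  then have a: "a > 0" using assms by simp
  have "(sqrt (b / a) - 1) / sqrt (1 + b / a) = (sqrt b - sqrt a) / sqrt (a + b)"
  proof -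
    have "sqrt (b/a) - 1 = (sqrt b - sqrt a) / sqrt a"
      using a by (simp add: real_sqrt_divide field_simps)
    moreover have "sqrt (1 + b/a) = sqrt (a + b) / sqrt a"
      using a by (simp add: real_sqrt_divide[symmetric] field_simps)
    ultimately show ?thesis using a by simp
  qed
  then show ?thesis using a assms
    by (auto simp: psi_def ennreal_sqrt_def ratio_def rho_phi_def)
qed

section \<open>Pointwise inequalities for \<open>rho_phi\<close>\<close>

lemma abs_rho_phi_le_1:
  assumes "0 \<le> a" "0 \<le> b"
  shows "\<bar>rho_phi a b\<bar> \<le> 1"
proof -
  have "\<bar>sqrt b - sqrt a\<bar> \<le> sqrt (a + b)"
  proof (rule real_le_rsqrt)
    show "\<bar>sqrt b - sqrt a\<bar>\<^sup>2 \<le> a + b"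
      using assms by (simp add: power2_diff)
  qed
  then show ?thesis using assms
    by (cases "a + b = 0") (auto simp: rho_phi_def abs_divide divide_le_eq)
qed

lemma rho_phi_swap: "rho_phi b a = - rho_phi a b"
  unfolding rho_phi_def by (simp add: add.commute[of b] minus_divide_left)

lemma measurable_rho_phi[measurable]:
  "f \<in> borel_measurable M \<Longrightarrow> g \<in> borel_measurable M \<Longrightarrow> (\<lambda>x. rho_phi (f x) (g x)) \<in> borel_measurable M"
  unfolding rho_phi_def by simp

text \<open>In the variable \<open>u = sqrt b\<close> the derivative has the sign of
  \<open>p * (p + u)\<close>. The case \<open>a = 0\<close> is separate because the quotient then
  jumps at \<open>b = 0\<close>. This makes the summands of T monotone wherever the first density is
  constant and the second one monotone.\<close>

lemma rho_phi_mono: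
  assumes a: "0 \<le> a" and b: "0 \<le> b" "b \<le> c"
  shows "rho_phi a b \<le> rho_phi a c"
proof (cases "a = 0")
  case True
  then show ?thesis using b by (cases "b = 0") (auto simp: rho_phi_def)
next
  case False
  then have a: "0 < a" using a by simp
  define q r p where "q = sqrt b" and "r = sqrt c" and "p = sqrt a"
  have p: "0 < p" "0 \<le> q" "q \<le> r" using a b by (auto simp: p_def q_def r_def)
  have eq: "a = p\<^sup>2" "b = q\<^sup>2" "c = r\<^sup>2" using a b by (auto simp: p_def q_def r_def)
  have "(\<lambda>u. (u - p) / sqrt (p\<^sup>2 + u\<^sup>2)) q \<le> (\<lambda>u. (u - p) / sqrt (p\<^sup>2 + u\<^sup>2)) r"
  proof (rule DERIV_nonneg_imp_nondecreasing[OF p(3)])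
    fix u assume u: "q \<le> u" "u \<le> r"
    have pos: "p\<^sup>2 + u\<^sup>2 > 0" using p by (simp add: add_pos_nonneg)
    have d: "((\<lambda>u. (u - p) / sqrt (p\<^sup>2 + u\<^sup>2)) has_real_derivative
       (sqrt (p\<^sup>2 + u\<^sup>2) - (u - p) * (u / sqrt (p\<^sup>2 + u\<^sup>2))) / (p\<^sup>2 + u\<^sup>2)) (at u)"
      using pos by (auto intro!: derivative_eq_intros simp: field_simps)
    have "sqrt (p\<^sup>2 + u\<^sup>2) - (u - p) * (u / sqrt (p\<^sup>2 + u\<^sup>2)) = (p\<^sup>2 + p * u) / sqrt (p\<^sup>2 + u\<^sup>2)"
    proof -
      define w where "w = sqrt (p\<^sup>2 + u\<^sup>2)"
      have "w > 0" "w * w = p\<^sup>2 + u\<^sup>2" using pos by (auto simp: w_def)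
      then show ?thesis unfolding w_def[symmetric] by (simp add: field_simps power2_eq_square)
    qed
    also have "\<dots> \<ge> 0" using p u by simp
    finally show "\<exists>y. ((\<lambda>u. (u - p) / sqrt (p\<^sup>2 + u\<^sup>2)) has_real_derivative y) (at u) \<and> 0 \<le> y"
      using d pos by (intro exI conjI) auto
  qed
  then show ?thesis
    unfolding rho_phi_def by (simp add: eq p p(2)[THEN order_trans, OF p(3)] order_less_imp_le)
qed

lemma sqrt_mean_ge:
  assumes "0 \<le> p" "0 \<le> (q::real)"
  shows "(p + q) / 2 \<le> sqrt ((p\<^sup>2 + q\<^sup>2) / 2)"
proof (rule real_le_rsqrt)
  have "0 \<le> (p - q)\<^sup>2" by simp
  then show "((p + q) / 2)\<^sup>2 \<le> (p\<^sup>2 + q\<^sup>2) / 2"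
    by (simp add: power2_eq_square algebra_simps divide_simps)
qed

text \<open>Midpoint convexity of the squared distance of roots, which is concavity of the square
  root.\<close>

lemma sqrt_mean_dist_le:
  assumes "0 \<le> a" "0 \<le> b" "0 \<le> s"
  shows "(sqrt ((a + b) / 2) - sqrt s)\<^sup>2 \<le> ((sqrt s - sqrt a)\<^sup>2 + (sqrt s - sqrt b)\<^sup>2) / 2"
proof -
  have "(sqrt a + sqrt b) / 2 \<le> sqrt ((a + b) / 2)"
    using sqrt_mean_ge[of "sqrt a" "sqrt b"] assms by simp
  then have "(sqrt a + sqrt b) / 2 * sqrt s \<le> sqrt ((a + b) / 2) * sqrt s"
    by (rule mult_right_mono) (use assms in simp)
  then show ?thesis using assms by (simp add: power2_diff field_simps)
qed

lemma rho_phi_eq: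
  assumes "0 \<le> a" "0 \<le> b"
  shows "rho_phi a b / sqrt 2 = (sqrt b - sqrt a) / (2 * sqrt ((a + b) / 2))"
proof -
  have "2 * sqrt ((a + b) / 2) = sqrt 2 * sqrt (a + b)"
    by (simp add: real_sqrt_divide real_div_sqrt field_simps)
  then show ?thesis by (simp add: rho_phi_def)
qed

text \<open>With \<open>w\<close> the root of the midpoint and \<open>z = sqrt s\<close>, completing
  the square writes the left side as \<open>z * (q - p)\<close> plus
  \<open>(w - z)^2 * (q - p) / (2 * w)\<close>. The first term is exactly half the difference of the
  squared distances plus \<open>(b - a) / 2\<close>. The second is at most
  \<open>(w - z)^2 / sqrt 2\<close>, because \<open>q <= sqrt 2 * w\<close>, and midpoint convexity
  applies. As 1/sqrt 2 < 1, the distance to \<open>b\<close> keeps a negative coefficient.\<close>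

lemma expectation_pointwise:
  assumes "0 \<le> a" "0 \<le> b" "0 \<le> s"
  shows "(sqrt b - sqrt a) * sqrt ((a + b) / 2) / 2 + s * (rho_phi a b / sqrt 2)
     \<le> (1 + 1 / sqrt 2) * ((sqrt s - sqrt a)\<^sup>2 / 2) - (1 - 1 / sqrt 2) * ((sqrt s - sqrt b)\<^sup>2 / 2)
        + (b - a) / 2"
proof -
  define p q z w where "p = sqrt a" and "q = sqrt b" and "z = sqrt s" and "w = sqrt ((a + b) / 2)"
  have nn: "0 \<le> p" "0 \<le> q" "0 \<le> z" "0 \<le> w" using assms by (auto simp: p_def q_def z_def w_def)
  have eq: "a = p\<^sup>2" "b = q\<^sup>2" "s = z\<^sup>2" using assms by (auto simp: p_def q_def z_def)
  have w2: "w\<^sup>2 = (p\<^sup>2 + q\<^sup>2) / 2" using assms eq by (simp add: w_def)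
  have "(q - p) * w / 2 + z\<^sup>2 * ((q - p) / (2 * w)) \<le> z * (q - p) + (w - z)\<^sup>2 / sqrt 2"
  proof (cases "w = 0")
    case True
    then have "p\<^sup>2 + q\<^sup>2 = 0" using w2 by simp
    then have "p = 0" "q = 0" by (auto simp: sum_power2_eq_zero_iff)
    then show ?thesis by simp
  next
    case False
    then have w: "w > 0" using nn by simp
    have "q \<le> sqrt 2 * w"
    proof (rule power2_le_imp_le)
      show "q\<^sup>2 \<le> (sqrt 2 * w)\<^sup>2" by (simp add: power_mult_distrib w2)
    qed (use nn in simp)
    then have "(q - p) / (2 * w) \<le> 1 / sqrt 2"
    proof -
      have "(q - p) / (2 * w) \<le> (sqrt 2 * w) / (2 * w)"
        using \<open>q \<le> sqrt 2 * w\<close> w nn by (intro divide_right_mono) auto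
      also have "\<dots> = 1 / sqrt 2" using w by (simp add: field_simps)
      finally show ?thesis .
    qed
    then have "(w - z)\<^sup>2 * ((q - p) / (2 * w)) \<le> (w - z)\<^sup>2 * (1 / sqrt 2)"
      by (rule mult_left_mono) simp
    moreover have "(w - z)\<^sup>2 * ((q - p) / (2 * w)) = (q - p) * w / 2 + z\<^sup>2 * ((q - p) / (2 * w)) - z * (q - p)"
      using w by (simp add: power2_eq_square field_simps)
    ultimately show ?thesis by simp
  qed
  also have "(w - z)\<^sup>2 / sqrt 2 \<le> (((z - p)\<^sup>2 + (z - q)\<^sup>2) / 2) / sqrt 2"
    using sqrt_mean_dist_le[OF assms] by (intro divide_right_mono) (auto simp: p_def q_def z_def w_def)
  also have "z * (q - p) = (z - p)\<^sup>2 / 2 - (z - q)\<^sup>2 / 2 + (b - a) / 2"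
    by (simp add: eq power2_eq_square field_simps)
  finally have "(q - p) * w / 2 + z\<^sup>2 * ((q - p) / (2 * w))
     \<le> (1 + 1 / sqrt 2) * ((z - p)\<^sup>2 / 2) - (1 - 1 / sqrt 2) * ((z - q)\<^sup>2 / 2) + (b - a) / 2"
    by (simp add: algebra_simps add_divide_distrib diff_divide_distrib)
  then show ?thesis
    unfolding rho_phi_eq[OF assms(1,2)] using assms by (simp add: p_def q_def z_def w_def)
qed

text \<open>The weight \<open>s\<close> is exchanged for the midpoint \<open>r\<close>, for which
  \<open>2 * r * phi^2\<close> is exactly \<open>(sqrt b - sqrt a)^2\<close>. The exchange costs
  \<open>2 * (sqrt r - sqrt s)^2\<close>, bounded by midpoint convexity. The constant 3 is 2 + 1
  from these two terms.\<close>

lemma variance_pointwise: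
  assumes "0 \<le> a" "0 \<le> b" "0 \<le> s"
  shows "s * (rho_phi a b)\<^sup>2 \<le> 3 * ((sqrt s - sqrt a)\<^sup>2 + (sqrt s - sqrt b)\<^sup>2)"
proof -
  define r where "r = (a + b) / 2"
  have r: "0 \<le> r" using assms by (simp add: r_def)
  have 0: "(sqrt s)\<^sup>2 \<le> 2 * (sqrt r)\<^sup>2 + 2 * (sqrt r - sqrt s)\<^sup>2"
    using zero_le_power2[of "sqrt s - 2 * sqrt r"] by (simp only: power2_eq_square) (simp add: algebra_simps del: real_sqrt_mult_self)
  have 1: "s \<le> 2 * r + 2 * (sqrt r - sqrt s)\<^sup>2"
    using 0 r assms by simp
  have f1: "(rho_phi a b)\<^sup>2 \<le> 1" using abs_rho_phi_le_1[OF assms(1,2)] by (simp add: abs_square_le_1)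
  have 2: "2 * r * (rho_phi a b)\<^sup>2 = (sqrt b - sqrt a)\<^sup>2"
  proof (cases "a + b = 0")
    case True
    then have "a = 0" "b = 0" using assms by auto
    then show ?thesis by (simp add: r_def rho_phi_def)
  next
    case False
    then show ?thesis using assms by (simp add: r_def rho_phi_def power_divide)
  qed
  have "s * (rho_phi a b)\<^sup>2 \<le> (2 * r + 2 * (sqrt r - sqrt s)\<^sup>2) * (rho_phi a b)\<^sup>2"
    by (rule mult_right_mono[OF 1]) simp
  also have "\<dots> = (sqrt b - sqrt a)\<^sup>2 + 2 * (sqrt r - sqrt s)\<^sup>2 * (rho_phi a b)\<^sup>2"
    using 2 by (simp add: algebra_simps)
  also have "2 * (sqrt r - sqrt s)\<^sup>2 * (rho_phi a b)\<^sup>2 \<le> 2 * (sqrt r - sqrt s)\<^sup>2 * 1"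
    by (rule mult_left_mono[OF f1]) simp
  also have "2 * (sqrt r - sqrt s)\<^sup>2 * 1 \<le> (sqrt s - sqrt a)\<^sup>2 + (sqrt s - sqrt b)\<^sup>2"
    using sqrt_mean_dist_le[OF assms] by (simp add: r_def)
  also have "(sqrt b - sqrt a)\<^sup>2 \<le> 2 * ((sqrt s - sqrt a)\<^sup>2 + (sqrt s - sqrt b)\<^sup>2)"
    using zero_le_power2[of "(sqrt s - sqrt a) + (sqrt s - sqrt b)"]
    by (simp only: power2_eq_square) (simp add: algebra_simps del: real_sqrt_mult_self)
  finally show ?thesis by simp
qed

section \<open>Integrated inequalities for densities\<close>

lemma densitiesD:
  assumes "f \<in> densities"
  shows "f \<in> borel_measurable borel" "0 \<le> f x" "integrable lborel f" "integral\<^sup>L lborel f = 1"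
proof -
  show *: "f \<in> borel_measurable borel" "0 \<le> f x" for x using assms by (auto simp: densities_def)
  have "has_bochner_integral lborel f 1"
    using assms by (intro has_bochner_integral_nn_integral) (auto simp: densities_def)
  then show "integrable lborel f" "integral\<^sup>L lborel f = 1"
    by (auto simp: has_bochner_integral_iff)
qed

lemma sqrt_diff_sq_le: "0 \<le> a \<Longrightarrow> 0 \<le> b \<Longrightarrow> (sqrt a - sqrt b)\<^sup>2 \<le> a + b"
  by (simp add: power2_diff)

lemma hellinger_integrable:
  assumes t: "t \<in> densities" and u: "u \<in> densities"
  shows "integrable lborel (\<lambda>x. (sqrt (t x) - sqrt (u x))\<^sup>2)"
proof (rule Bochner_Integration.integrable_bound)
  show "integrable lborel (\<lambda>x. t x + u x)" using densitiesD[OF t] densitiesD[OF u] by simp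
  show "(\<lambda>x. (sqrt (t x) - sqrt (u x))\<^sup>2) \<in> borel_measurable lborel"
    using densitiesD(1)[OF t] densitiesD(1)[OF u] by measurable
  show "AE x in lborel. norm ((sqrt (t x) - sqrt (u x))\<^sup>2) \<le> norm (t x + u x)"
    using sqrt_diff_sq_le densitiesD(2)[OF t] densitiesD(2)[OF u] by (intro AE_I2) (simp add: abs_of_nonneg)
qed

lemma hellinger_sq: "(hellinger t u)\<^sup>2 = 1 / 2 * (\<integral>x. (sqrt (t x) - sqrt (u x))\<^sup>2 \<partial>lborel)"
  unfolding hellinger_def by (subst real_sqrt_pow2) auto

lemma hellinger_nonneg: "0 \<le> hellinger t u"
  unfolding hellinger_def by simp

lemma hellinger_sq_le_1:
  assumes t: "t \<in> densities" and u: "u \<in> densities"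
  shows "(hellinger t u)\<^sup>2 \<le> 1"
proof -
  have "(\<integral>x. (sqrt (t x) - sqrt (u x))\<^sup>2 \<partial>lborel) \<le> (\<integral>x. t x + u x \<partial>lborel)"
    using densitiesD[OF t] densitiesD[OF u]
    by (intro integral_mono hellinger_integrable t u) (auto intro!: sqrt_diff_sq_le)
  also have "\<dots> = 2" using densitiesD[OF t] densitiesD[OF u] by simp
  finally show ?thesis by (simp add: hellinger_sq)
qed

lemma hellinger_sq_triangle:
  assumes s: "s \<in> densities" and t: "t \<in> densities" and u: "u \<in> densities"
  shows "(hellinger s u)\<^sup>2 \<le> 2 * (hellinger s t)\<^sup>2 + 2 * (hellinger t u)\<^sup>2"
proof -
  have pw: "(a - c)\<^sup>2 \<le> 2 * (a - b)\<^sup>2 + 2 * (b - c)\<^sup>2" for a b c :: real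
    using zero_le_power2[of "(a - b) - (b - c)"] by (simp add: power2_eq_square algebra_simps)
  have "(\<integral>x. (sqrt (s x) - sqrt (u x))\<^sup>2 \<partial>lborel)
     \<le> (\<integral>x. 2 * (sqrt (s x) - sqrt (t x))\<^sup>2 + 2 * (sqrt (t x) - sqrt (u x))\<^sup>2 \<partial>lborel)"
    by (intro integral_mono hellinger_integrable s u Bochner_Integration.integrable_add
        integrable_mult_right t pw)
  then show ?thesis using hellinger_integrable[OF s t] hellinger_integrable[OF t u]
    by (simp add: hellinger_sq)
qed

lemma hellinger_commute: "hellinger t u = hellinger u t"
  unfolding hellinger_def by (simp add: power2_commute)

lemma mean_density:
  assumes t: "t \<in> densities" and u: "u \<in> densities"
  shows "(\<lambda>x. (t x + u x) / 2) \<in> densities"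
proof -
  have "has_bochner_integral lborel (\<lambda>x. (t x + u x) / 2) 1"
    using densitiesD[OF t] densitiesD[OF u] by (simp add: has_bochner_integral_iff)
  moreover have "0 \<le> (t x + u x) / 2" for x using densitiesD(2)[OF t] densitiesD(2)[OF u] by simp
  ultimately show ?thesis using densitiesD(1)[OF t] densitiesD(1)[OF u]
    by (auto simp: densities_def has_bochner_integral_iff nn_integral_eq_integral)
qed

text \<open>The integrand of the difference of squared Hellinger distances to the midpoint, up to
  the term \<open>(b - a) / 2\<close>, which integrates to 0 for two densities. This form is visibly
  antisymmetric.\<close>

definition rho_gap :: "real \<Rightarrow> real \<Rightarrow> real" where
  "rho_gap a b = (sqrt b - sqrt a) * sqrt ((a + b) / 2)"

lemma rho_gap_eq:
  assumes "0 \<le> a" "0 \<le> b"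
  shows "rho_gap a b = ((sqrt a - sqrt ((a + b) / 2))\<^sup>2 - (sqrt b - sqrt ((a + b) / 2))\<^sup>2 + (b - a)) / 2"
  using assms unfolding rho_gap_def by (simp add: power2_diff) (simp add: algebra_simps)

lemma
  assumes t: "t \<in> densities" and u: "u \<in> densities"
  shows rho_gap_integrable: "integrable lborel (\<lambda>x. rho_gap (t x) (u x))"
    and hellinger_gap: "(hellinger t (\<lambda>x. (t x + u x) / 2))\<^sup>2 - (hellinger u (\<lambda>x. (t x + u x) / 2))\<^sup>2
      = (\<integral>x. rho_gap (t x) (u x) \<partial>lborel)"
proof -
  have eq: "(\<lambda>x. rho_gap (t x) (u x)) = (\<lambda>x. ((sqrt (t x) - sqrt ((t x + u x) / 2))\<^sup>2
      - (sqrt (u x) - sqrt ((t x + u x) / 2))\<^sup>2 + (u x - t x)) / 2)"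
    using densitiesD(2)[OF t] densitiesD(2)[OF u] by (auto simp: rho_gap_eq fun_eq_iff)
  have i: "integrable lborel (\<lambda>x. (sqrt (t x) - sqrt ((t x + u x) / 2))\<^sup>2)"
    "integrable lborel (\<lambda>x. (sqrt (u x) - sqrt ((t x + u x) / 2))\<^sup>2)"
    using hellinger_integrable[OF t mean_density[OF t u]] hellinger_integrable[OF u mean_density[OF t u]]
    by auto
  show "integrable lborel (\<lambda>x. rho_gap (t x) (u x))"
    unfolding eq using i densitiesD[OF t] densitiesD[OF u] by simp
  show "(hellinger t (\<lambda>x. (t x + u x) / 2))\<^sup>2 - (hellinger u (\<lambda>x. (t x + u x) / 2))\<^sup>2
      = (\<integral>x. rho_gap (t x) (u x) \<partial>lborel)"
    unfolding eq hellinger_sq using i densitiesD[OF t] densitiesD[OF u] by simp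
qed

lemma rho_T_eq:
  assumes t: "t \<in> densities" and u: "u \<in> densities"
  shows "rho_T n X t u = real n / 2 * (\<integral>x. rho_gap (t x) (u x) \<partial>lborel)
     + (\<Sum>i=1..n. rho_phi (t (X i)) (u (X i))) / sqrt 2"
  unfolding rho_T_def hellinger_gap[OF t u]
  by (simp add: psi_ratio densitiesD(2)[OF t] densitiesD(2)[OF u])

text \<open>Antisymmetry lets upper bounds on T with first argument fixed control both the criterion
  there and the value at a near minimizer.\<close>

lemma rho_T_swap:
  assumes t: "t \<in> densities" and u: "u \<in> densities"
  shows "rho_T n X u t = - rho_T n X t u"
proof -
  have "rho_gap (u x) (t x) = - rho_gap (t x) (u x)" for x
    by (simp add: rho_gap_def algebra_simps)
  then show ?thesis unfolding rho_T_eq[OF t u] rho_T_eq[OF u t]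
    by (simp add: rho_phi_swap[of "u _"] sum_negf)
qed

lemma rho_phi_integrable:
  assumes s: "s \<in> densities" and t: "t \<in> densities" and u: "u \<in> densities"
  shows "integrable lborel (\<lambda>x. s x * rho_phi (t x) (u x))"
    and "integrable lborel (\<lambda>x. s x * (rho_phi (t x) (u x))\<^sup>2)"
proof -
  note [measurable] = densitiesD(1)[OF s] densitiesD(1)[OF t] densitiesD(1)[OF u]
  have b: "\<bar>rho_phi (t x) (u x)\<bar> \<le> 1" for x
    by (intro abs_rho_phi_le_1 densitiesD(2) t u)
  have b2: "(rho_phi (t x) (u x))\<^sup>2 \<le> 1" for x using b by (simp add: abs_square_le_1)
  show "integrable lborel (\<lambda>x. s x * rho_phi (t x) (u x))"
    by (rule Bochner_Integration.integrable_bound[OF densitiesD(3)[OF s]])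
      (use b densitiesD(2)[OF s] in \<open>auto simp: abs_mult intro!: mult_left_le\<close>)
  show "integrable lborel (\<lambda>x. s x * (rho_phi (t x) (u x))\<^sup>2)"
    by (rule Bochner_Integration.integrable_bound[OF densitiesD(3)[OF s]])
      (use b2 densitiesD(2)[OF s] in \<open>auto simp: abs_mult intro!: mult_left_le\<close>)
qed

text \<open>The left side is the mean of T divided by \<open>n\<close>. The pointwise term
  \<open>(b - a) / 2\<close> vanishes on integration since both functions have mass 1.\<close>

lemma rho_expectation_le:
  assumes s: "s \<in> densities" and t: "t \<in> densities" and u: "u \<in> densities"
  shows "(\<integral>x. rho_gap (t x) (u x) \<partial>lborel) / 2 + (\<integral>x. s x * rho_phi (t x) (u x) \<partial>lborel) / sqrt 2
    \<le> (1 + 1 / sqrt 2) * (hellinger s t)\<^sup>2 - (1 - 1 / sqrt 2) * (hellinger s u)\<^sup>2"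
proof -
  note i = rho_gap_integrable[OF t u] rho_phi_integrable(1)[OF s t u]
    hellinger_integrable[OF s t] hellinger_integrable[OF s u] densitiesD(3)[OF t] densitiesD(3)[OF u]
  have "(\<integral>x. rho_gap (t x) (u x) / 2 + s x * rho_phi (t x) (u x) / sqrt 2 \<partial>lborel)
    \<le> (\<integral>x. (1 + 1 / sqrt 2) * ((sqrt (s x) - sqrt (t x))\<^sup>2 / 2)
         - (1 - 1 / sqrt 2) * ((sqrt (s x) - sqrt (u x))\<^sup>2 / 2) + (u x - t x) / 2 \<partial>lborel)"
    using i expectation_pointwise[OF densitiesD(2)[OF t] densitiesD(2)[OF u] densitiesD(2)[OF s]]
    by (intro integral_mono) (auto simp: rho_gap_def)
  then show ?thesis using i densitiesD(4)[OF t] densitiesD(4)[OF u]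
    by (simp add: hellinger_sq)
qed

lemma rho_variance_le:
  assumes s: "s \<in> densities" and t: "t \<in> densities" and u: "u \<in> densities"
  shows "(\<integral>x. s x * (rho_phi (t x) (u x))\<^sup>2 \<partial>lborel) \<le> 6 * ((hellinger s t)\<^sup>2 + (hellinger s u)\<^sup>2)"
proof -
  note i = rho_phi_integrable(2)[OF s t u] hellinger_integrable[OF s t] hellinger_integrable[OF s u]
  have "(\<integral>x. s x * (rho_phi (t x) (u x))\<^sup>2 \<partial>lborel)
    \<le> (\<integral>x. 3 * ((sqrt (s x) - sqrt (t x))\<^sup>2 + (sqrt (s x) - sqrt (u x))\<^sup>2) \<partial>lborel)"
    using i variance_pointwise[OF densitiesD(2)[OF t] densitiesD(2)[OF u] densitiesD(2)[OF s]]
    by (intro integral_mono) auto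
  then show ?thesis using i by (simp add: hellinger_sq)
qed

text \<open>Where \<open>t\<close> vanishes, \<open>s\<close> coincides with
  \<open>(sqrt s - sqrt t)^2\<close>; the 2 undoes the 1/2 in \<open>hellinger\<close>.\<close>

lemma mass_zero_set_le:
  assumes s: "s \<in> densities" and t: "t \<in> densities"
  shows "(\<integral>x. s x * indicator {x. t x = 0} x \<partial>lborel) \<le> 2 * (hellinger s t)\<^sup>2"
proof -
  note [measurable] = densitiesD(1)[OF s] densitiesD(1)[OF t]
  have "integrable lborel (\<lambda>x. s x * indicator {x. t x = 0} x)"
    by (rule Bochner_Integration.integrable_bound[OF densitiesD(3)[OF s]])
      (auto simp: indicator_def densitiesD(2)[OF s])
  then have "(\<integral>x. s x * indicator {x. t x = 0} x \<partial>lborel) \<le> (\<integral>x. (sqrt (s x) - sqrt (t x))\<^sup>2 \<partial>lborel)"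
    using densitiesD(2)[OF s] by (intro integral_mono hellinger_integrable s t) (auto simp: indicator_def)
  then show ?thesis by (simp add: hellinger_sq)
qed

section \<open>Uniform deviations over unions of intervals\<close>

abbreviation sample_count :: "nat \<Rightarrow> real set \<Rightarrow> (nat \<Rightarrow> real) \<Rightarrow> real" where
  "sample_count n A X \<equiv> (\<Sum>i=1..n. indicator A (X i))"

abbreviation law :: "(real \<Rightarrow> real) \<Rightarrow> real measure" where
  "law s \<equiv> density lborel (\<lambda>x. ennreal (s x))"

lemma prob_space_law:
  assumes "s \<in> densities" shows "prob_space (law s)"
  by (rule prob_spaceI) (use assms in \<open>simp add: densities_def emeasure_density\<close>)

lemma prob_space_sample:
  assumes "s \<in> densities" shows "prob_space (sample_measure n s)"
  unfolding sample_measure_def by (intro prob_space_PiM prob_space_law assms)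

lemma sets_sample: "sets (sample_measure n s) = sets (\<Pi>\<^sub>M i\<in>{1..n}. borel)"
  unfolding sample_measure_def by (rule sets_PiM_cong) auto

lemma space_sample: "space (sample_measure n s) = space (\<Pi>\<^sub>M i\<in>{1..n}. borel)"
  by (rule sets_eq_imp_space_eq[OF sets_sample])

lemma measurable_sample_component:
  assumes "i \<in> {1..n}"
  shows "(\<lambda>X. X i) \<in> sample_measure n s \<rightarrow>\<^sub>M borel"
  unfolding measurable_cong_sets[OF sets_sample refl] using assms by (rule measurable_component_singleton)

lemma measurable_sample_count[measurable]:
  assumes "A \<in> sets borel"
  shows "sample_count n A \<in> borel_measurable (sample_measure n s)"
proof (rule borel_measurable_sum)
  fix i assume "i \<in> {1..n}"
  then show "(\<lambda>X. indicator A (X i) :: real) \<in> borel_measurable (sample_measure n s)"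
    using assms by (intro measurable_compose[OF measurable_sample_component]) auto
qed

lemma integral_law:
  fixes g :: "real \<Rightarrow> real"
  assumes "s \<in> densities" "g \<in> borel_measurable borel"
  shows "(\<integral>x. g x \<partial>law s) = (\<integral>x. s x * g x \<partial>lborel)"
  using assms densitiesD[OF assms(1)] by (subst integral_density) auto

section \<open>Chernoff bounds for one set\<close>

lemma exp_le_quadratic:
  assumes "\<bar>x\<bar> \<le> (1::real)"
  shows "exp x \<le> 1 + x + x\<^sup>2"
proof (cases "0 \<le> x")
  case True then show ?thesis using exp_bound assms by auto
next
  case False
  define z where "z = - x"
  have z: "0 < z" "z \<le> 1" using False assms by (auto simp: z_def)
  \<comment> \<open>The product equals \<open>1 + z^3\<close>.\<close>
  have "1 \<le> (1 + z) * (1 - z + z\<^sup>2)" using z by (simp add: algebra_simps power2_eq_square)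
  also have "\<dots> \<le> exp z * (1 - z + z\<^sup>2)"
  proof (rule mult_right_mono)
    show "1 + z \<le> exp z" by (simp add: add.commute)
    show "0 \<le> 1 - z + z\<^sup>2" using z by simp
  qed
  finally have "exp (- z) \<le> 1 - z + z\<^sup>2" by (simp add: exp_minus field_simps)
  then show ?thesis by (simp add: z_def)
qed

text \<open>Markov's inequality for the exponential moment, which factorises over the sample into
  \<open>n\<close> factors \<open>1 + (exp l - 1) * p\<close>. Since \<open>l\<close> may be
  negative and the event keeps the factor \<open>l\<close>, both tails are covered at once.\<close>

lemma chernoff_one_sided:
  assumes s: "s \<in> densities" and A: "A \<in> sets borel" and l: "\<bar>l\<bar> \<le> 1"
  defines "p \<equiv> measure (law s) A"
  shows "measure (sample_measure n s)
      {X \<in> space (sample_measure n s). n * p * l\<^sup>2 + y \<le> l * (sample_count n A X - n * p)} \<le> exp (- y)"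
proof -
  interpret L: prob_space "law s" by (rule prob_space_law[OF s])
  interpret M: prob_space "sample_measure n s" by (rule prob_space_sample[OF s])
  interpret product_sigma_finite "\<lambda>i::nat. law s"
    by (simp add: product_sigma_finite_def L.sigma_finite_measure_axioms)
  have [measurable]: "A \<in> sets (law s)" using A by simp
  define f where "f = (\<lambda>x. exp (l * indicator A x))"
  have f_eq: "f = (\<lambda>x. 1 + (exp l - 1) * indicator A x)"
    by (auto simp: f_def fun_eq_iff indicator_def)
  have i: "integrable (law s) f" unfolding f_eq
    by (intro Bochner_Integration.integrable_add integrable_mult_right integrable_real_indicator)
      (auto simp: L.emeasure_eq_measure A)
  have e: "integral\<^sup>L (law s) f = 1 + (exp l - 1) * p"
    unfolding f_eq p_def using A by (subst Bochner_Integration.integral_add) (auto simp: L.emeasure_eq_measure L.prob_space[simplified])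
  have p: "0 \<le> p" "p \<le> 1" by (auto simp: p_def)
  have "1 + (exp l - 1) * p \<le> 1 + (l + l\<^sup>2) * p"
    using exp_le_quadratic[OF l] p by (intro add_left_mono mult_right_mono) auto
  also have "\<dots> \<le> exp ((l + l\<^sup>2) * p)" by (rule exp_ge_add_one_self)
  finally have e': "1 + (exp l - 1) * p \<le> exp ((l + l\<^sup>2) * p)" .
  have e0: "0 \<le> 1 + (exp l - 1) * p" unfolding e[symmetric] f_def by simp
  have exp_eq: "exp (l * sample_count n A X) = (\<Prod>i\<in>{1..n}. f (X i))" for X
    unfolding f_def sum_distrib_left by (rule exp_sum) simp
  have int: "integrable (sample_measure n s) (\<lambda>X. exp (l * sample_count n A X))"
    unfolding exp_eq sample_measure_def by (rule product_integrable_prod) (use i in auto)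
  have "(\<integral>X. exp (l * sample_count n A X) \<partial>sample_measure n s) = (1 + (exp l - 1) * p) ^ n"
    unfolding exp_eq sample_measure_def by (subst product_integral_prod) (use i e in auto)
  also have "\<dots> \<le> exp ((l + l\<^sup>2) * p) ^ n" by (rule power_mono[OF e' e0])
  also have "\<dots> = exp (n * (l + l\<^sup>2) * p)" by (simp add: exp_of_nat_mult[symmetric] ac_simps)
  finally have mgf: "(\<integral>X. exp (l * sample_count n A X) \<partial>sample_measure n s) \<le> exp (n * (l + l\<^sup>2) * p)" .
  define c where "c = exp (n * p * l\<^sup>2 + y + l * n * p)"
  have "{X \<in> space (sample_measure n s). n * p * l\<^sup>2 + y \<le> l * (sample_count n A X - n * p)}
     = {X \<in> space (sample_measure n s). c \<le> exp (l * sample_count n A X)}"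
    by (auto simp: c_def algebra_simps)
  then have "measure (sample_measure n s)
      {X \<in> space (sample_measure n s). n * p * l\<^sup>2 + y \<le> l * (sample_count n A X - n * p)}
     \<le> (\<integral>X. exp (l * sample_count n A X) \<partial>sample_measure n s) / c"
    using integral_Markov_inequality_measure[OF int, of "{}" c] by (simp add: c_def)
  also have "\<dots> \<le> exp (n * (l + l\<^sup>2) * p) / c" using mgf by (simp add: c_def divide_right_mono)
  also have "\<dots> = exp (- y)" by (simp add: c_def exp_diff[symmetric] algebra_simps)
  finally show ?thesis .
qed

lemma chernoff_two_sided:
  assumes s: "s \<in> densities" and A: "A \<in> sets borel" and y: "0 < y"
  defines "p \<equiv> measure (law s) A"
  shows "measure (sample_measure n s)
      {X \<in> space (sample_measure n s). 2 * sqrt (n * p * y) + 2 * y < \<bar>sample_count n A X - n * p\<bar>}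
      \<le> 2 * exp (- y)"
proof -
  interpret M: prob_space "sample_measure n s" by (rule prob_space_sample[OF s])
  note [measurable] = A
  define v where "v = n * p"
  have v: "0 \<le> v" by (simp add: v_def p_def)
  \<comment> \<open>This balances \<open>v * l^2\<close> against \<open>y\<close>; the cap at 1
    keeps \<open>l\<close> in the range of the quadratic bound on \<open>exp\<close>.\<close>
  define l where "l = (if v \<le> y then 1 else sqrt (y / v))"
  have l: "0 < l" "l \<le> 1" using v y by (auto simp: l_def)
  have key: "v * l\<^sup>2 + y \<le> l * (2 * sqrt (v * y) + 2 * y)"
  proof (cases "v \<le> y")
    case True then show ?thesis using v y by (simp add: l_def add_increasing)
  next
    case False
    then have "v > 0" using y by simp
    have "l * sqrt (v * y) = y"
      using False y by (simp add: l_def real_sqrt_mult[symmetric])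
    moreover have "v * l\<^sup>2 = y" using False y by (simp add: l_def)
    moreover have "0 \<le> l * (2 * y)" using l y by simp
    ultimately show ?thesis unfolding distrib_left by linarith
  qed
  let ?E = "\<lambda>l. {X \<in> space (sample_measure n s). n * p * l\<^sup>2 + y \<le> l * (sample_count n A X - n * p)}"
  have sub: "{X \<in> space (sample_measure n s). 2 * sqrt (n * p * y) + 2 * y < \<bar>sample_count n A X - n * p\<bar>}
    \<subseteq> ?E l \<union> ?E (- l)"
  proof safe
    fix X assume X: "2 * sqrt (n * p * y) + 2 * y < \<bar>sample_count n A X - n * p\<bar>"
      and n: "\<not> n * p * (- l)\<^sup>2 + y \<le> (- l) * (sample_count n A X - n * p)"
    have "v * l\<^sup>2 + y \<le> l * \<bar>sample_count n A X - v\<bar>"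
      using X l(1) by (intro order_trans[OF key] mult_left_mono) (auto simp: v_def)
    then show "n * p * l\<^sup>2 + y \<le> l * (sample_count n A X - n * p)"
      using n by (auto simp: v_def abs_if split: if_splits)
  qed
  have "measure (sample_measure n s) (?E l \<union> ?E (- l))
    \<le> measure (sample_measure n s) (?E l) + measure (sample_measure n s) (?E (- l))"
    by (rule measure_Un_le) measurable
  also have "\<dots> \<le> exp (- y) + exp (- y)"
    unfolding p_def using l by (intro add_mono chernoff_one_sided s A) auto
  finally have "measure (sample_measure n s) (?E l \<union> ?E (- l)) \<le> 2 * exp (- y)" by simp
  moreover have "?E l \<union> ?E (- l) \<in> M.events" by measurable
  ultimately show ?thesis using M.finite_measure_mono[OF sub] by linarith
qed

text \<open>Generating function argument: \<open>x ^ e <= x ^ card D\<close> for each counted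
  subset, and summing \<open>x ^ card D\<close> over all subsets gives \<open>(1 + x) ^ n\<close>.
  The value used later is \<open>x = m / n\<close>.\<close>

lemma card_small_subsets_le:
  fixes x :: real
  assumes x: "0 < x" "x \<le> 1"
  shows "card {D. D \<subseteq> {..<n::nat} \<and> card D \<le> e} * x ^ e \<le> (1 + x) ^ n"
proof -
  have "card {D. D \<subseteq> {..<n} \<and> card D \<le> e} * x ^ e = (\<Sum>D\<in>{D. D \<subseteq> {..<n} \<and> card D \<le> e}. x ^ e)"
    by simp
  also have "\<dots> \<le> (\<Sum>D\<in>{D. D \<subseteq> {..<n} \<and> card D \<le> e}. x ^ card D)"
    using x by (intro sum_mono power_decreasing) auto
  also have "\<dots> \<le> (\<Sum>D\<in>Pow {..<n}. x ^ card D)"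
    using x by (intro sum_mono2) auto
  also have "\<dots> = (\<Prod>i<n. x + 1)"
    by (subst prod_add) auto
  finally show ?thesis by (simp add: add.commute)
qed

text \<open>The law has a Lebesgue density, hence a continuous cdf, so the intermediate value
  theorem provides exact quantiles. The cells are encoded by a monotone index function: runs of
  cells are preimages of runs of indices, and surjectivity says that no cell is empty.\<close>

lemma quantile_index:
  assumes s: "s \<in> densities" and n: "1 \<le> n"
  obtains idx :: "real \<Rightarrow> nat" where "mono idx" "range idx = {..<n}"
    "\<And>i. measure (law s) {x. idx x = i} \<le> 1 / n"
proof -
  interpret L: prob_space "law s" by (rule prob_space_law[OF s])
  interpret L: real_distribution "law s" by standard simp
  have "measure (law s) {x} = 0" for x
  proof -
    have "{x} \<in> null_sets lborel" by (auto simp: null_sets_def)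
    then have "emeasure (law s) {x} = 0"
      using densitiesD(1)[OF s] by (simp add: emeasure_density nn_integral_null_set)
    then show ?thesis by (simp add: measure_def)
  qed
  then have cont: "isCont (cdf (law s)) x" for x by (simp add: L.isCont_cdf)
  have "\<exists>q. cdf (law s) q = j / n" if "1 \<le> j" "j < n" for j
  proof -
    have j: "0 < real j / n" "real j / n < 1" using that n by auto
    have "\<forall>\<^sub>F x in at_bot. cdf (law s) x < j / n"
      using L.cdf_lim_at_bot j by (auto intro: order_tendstoD)
    then obtain lo where lo: "cdf (law s) lo < j / n"
      by (auto simp: eventually_at_bot_linorder)
    have "\<forall>\<^sub>F x in at_top. j / n < cdf (law s) x"
      using L.cdf_lim_at_top_prob j by (auto intro: order_tendstoD)
    then obtain hi where hi: "j / n < cdf (law s) hi"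
      by (auto simp: eventually_at_top_linorder)
    have "lo \<le> hi" using lo hi L.cdf_nondecreasing[of hi lo] by linarith
    then show ?thesis using IVT[of "cdf (law s)" lo "j / n" hi] lo hi cont by auto
  qed
  then obtain q where q: "\<And>j. 1 \<le> j \<Longrightarrow> j < n \<Longrightarrow> cdf (law s) (q j) = j / n" by metis
  have qmono: "q i < q j" if "1 \<le> i" "i < j" "j < n" for i j
  proof (rule ccontr)
    assume "\<not> q i < q j"
    then have "cdf (law s) (q j) \<le> cdf (law s) (q i)" by (intro L.cdf_nondecreasing) simp
    then show False using that q[of i] q[of j] n by (simp add: divide_le_cancel)
  qed
  have qmono': "q i \<le> q j" if "1 \<le> i" "i \<le> j" "j < n" for i j
    using qmono[of i j] that by (cases "i = j") auto
  \<comment> \<open>Counting quantiles strictly below \<open>x\<close> makes the cells half-open,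
    \<open>(q i, q (i + 1)]\<close>, the two outermost ones being unbounded.\<close>
  define idx where "idx = (\<lambda>x. card {j \<in> {1..<n}. q j < x})"
  have mono: "mono idx" unfolding idx_def by (intro monoI card_mono) auto
  have idx_less: "idx x < n" for x
  proof -
    have "idx x \<le> card {1..<n}" unfolding idx_def by (intro card_mono) auto
    then show ?thesis using n by simp
  qed
  have lower: "q i < x" if "idx x = i" "1 \<le> i" for x i
  proof (rule ccontr)
    assume "\<not> q i < x"
    have "i < n" using idx_less[of x] that by simp
    have "{j \<in> {1..<n}. q j < x} \<subseteq> {1..<i}"
    proof
      fix j assume j: "j \<in> {j \<in> {1..<n}. q j < x}"
      have "j < i"
      proof (rule ccontr)
        assume "\<not> j < i"
        then have "q i \<le> q j" using j that by (intro qmono') auto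
        then show False using j \<open>\<not> q i < x\<close> by simp
      qed
      then show "j \<in> {1..<i}" using j by simp
    qed
    then have "idx x \<le> card {1..<i}" unfolding idx_def by (intro card_mono) auto
    then show False using that by simp
  qed
  have upper: "x \<le> q (Suc i)" if "idx x = i" "Suc i < n" for x i
  proof (rule ccontr)
    assume "\<not> x \<le> q (Suc i)"
    have "{1..Suc i} \<subseteq> {j \<in> {1..<n}. q j < x}"
    proof
      fix j assume j: "j \<in> {1..Suc i}"
      then have "q j \<le> q (Suc i)" using that by (intro qmono') auto
      then show "j \<in> {j \<in> {1..<n}. q j < x}" using j \<open>\<not> x \<le> q (Suc i)\<close> that by auto
    qed
    then have "card {1..Suc i} \<le> idx x" unfolding idx_def by (intro card_mono) auto
    then show False using that by simp
  qed
  have "i \<in> range idx" if i: "i < n" for i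
  proof (cases "Suc i < n")
    case True
    have "{j \<in> {1..<n}. q j < q (Suc i)} = {1..i}"
    proof (intro set_eqI iffI)
      fix j assume j: "j \<in> {j \<in> {1..<n}. q j < q (Suc i)}"
      then have "\<not> Suc i \<le> j" using qmono'[of "Suc i" j] by auto
      then show "j \<in> {1..i}" using j by auto
    next
      fix j assume j: "j \<in> {1..i}"
      then show "j \<in> {j \<in> {1..<n}. q j < q (Suc i)}" using True qmono[of j "Suc i"] by auto
    qed
    then have "idx (q (Suc i)) = i" by (simp add: idx_def)
    then show ?thesis by (metis rangeI)
  next
    case False
    then have i': "i = n - 1" using i by simp
    have "{j \<in> {1..<n}. q j < q (n - 1) + 1} = {1..<n}"
    proof (intro set_eqI iffI)
      fix j assume j: "j \<in> {1..<n}"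
      then have "q j \<le> q (n - 1)" by (intro qmono') auto
      then show "j \<in> {j \<in> {1..<n}. q j < q (n - 1) + 1}" using j by auto
    qed auto
    then have "idx (q (n - 1) + 1) = i" by (simp add: idx_def i')
    then show ?thesis by (metis rangeI)
  qed
  then have range: "range idx = {..<n}" using idx_less by auto
  have "measure (law s) {x. idx x = i} \<le> 1 / n" for i
  proof -
    \<comment> \<open>The first and the last cell are bounded by one quantile only, and by none if
      \<open>n = 1\<close>; indices from \<open>n\<close> on have empty cells.\<close>
    consider "n \<le> i" | "i = 0" "n = 1" | "i = 0" "1 < n" | "1 \<le> i" "Suc i < n" | "1 \<le> i" "Suc i = n"
      using n by linarith
    then show ?thesis
    proof cases
      case 1
      then have "{x. idx x = i} = {}" using idx_less leD by blast
      then show ?thesis by simp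
    next
      case 2 then show ?thesis by simp
    next
      case 3
      have "measure (law s) {x. idx x = i} \<le> measure (law s) {..q 1}"
      proof (intro L.finite_measure_mono subsetI)
        fix x assume "x \<in> {x. idx x = i}"
        then show "x \<in> {..q 1}" using upper[of x i] 3 by simp
      qed simp
      also have "\<dots> = 1 / n" using q[of 1] 3 by (simp add: cdf_def)
      finally show ?thesis .
    next
      case 4
      have "measure (law s) {x. idx x = i} \<le> measure (law s) {q i<..q (Suc i)}"
      proof (intro L.finite_measure_mono subsetI)
        fix x assume "x \<in> {x. idx x = i}"
        then show "x \<in> {q i<..q (Suc i)}" using upper[of x i] lower[of x i] 4 by simp
      qed simp
      also have "\<dots> = 1 / n"
        using q[of i] q[of "Suc i"] 4 qmono[of i "Suc i"]
        by (subst L.cdf_diff_eq[symmetric]) (auto simp: diff_divide_distrib[symmetric])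
      finally show ?thesis .
    next
      case 5
      have "measure (law s) {x. idx x = i} \<le> measure (law s) (space (law s) - {..q i})"
      proof (intro L.finite_measure_mono subsetI)
        fix x assume "x \<in> {x. idx x = i}"
        then show "x \<in> space (law s) - {..q i}" using lower[of x i] 5 by simp
      qed simp
      also have "\<dots> = 1 - cdf (law s) (q i)"
        by (subst L.prob_compl) (auto simp: cdf_def)
      also have "\<dots> = 1 / n" using q[of i] 5 by (auto simp: field_simps)
      finally show ?thesis .
    qed
  qed
  with mono range that show thesis by blast
qed

section \<open>Bracketing by unions of quantile cells\<close>

lemma sets_index:
  assumes "mono (idx :: real \<Rightarrow> nat)"
  shows "{x. idx x \<in> B} \<in> sets borel"
proof -
  have "mono (\<lambda>x. real (idx x))"
    by (rule monoI) (simp add: monoD[OF assms])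
  then have m: "(\<lambda>x. real (idx x)) \<in> borel_measurable borel" by (rule borel_measurable_mono)
  have "countable (real ` B)" by simp
  then have "real ` B \<in> sets borel" by (rule sets.countable[rotated]) simp
  from measurable_sets[OF m this] have "(\<lambda>x. real (idx x)) -` (real ` B) \<in> sets borel" by simp
  also have "(\<lambda>x. real (idx x)) -` (real ` B) = {x. idx x \<in> B}"
    by (simp add: vimage_def inj_image_mem_iff[OF inj_of_nat])
  finally show ?thesis .
qed

text \<open>Stands for ``\<open>A\<close> is a union of few intervals'': \<open>A\<close> can change only at the points of \<open>F\<close>.\<close>
definition cuts :: "real set \<Rightarrow> real set \<Rightarrow> bool" where
  "cuts F A \<longleftrightarrow> finite F \<and> (\<forall>x y. x < y \<longrightarrow> {x..y} \<inter> F = {} \<longrightarrow> (x \<in> A \<longleftrightarrow> y \<in> A))"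

lemma cuts_Compl: "cuts F A \<Longrightarrow> cuts F (- A)"
  by (auto simp: cuts_def)

text \<open>A union of runs of cells is coded by the small set \<open>D\<close> of indices where membership changes.\<close>
lemma parity_representation:
  fixes B :: "nat set"
  assumes B: "B \<subseteq> {..<n}" and c: "card {i. Suc i < n \<and> (i \<in> B) \<noteq> (Suc i \<in> B)} \<le> e"
  obtains D where "D \<subseteq> {..<n}" "card D \<le> Suc e" "\<And>i. i < n \<Longrightarrow> i \<in> B \<longleftrightarrow> odd (card (D \<inter> {..i}))"
proof -
  let ?G = "{i. Suc i < n \<and> (i \<in> B) \<noteq> (Suc i \<in> B)}"
  \<comment> \<open>A change between \<open>i\<close> and \<open>Suc i\<close> is recorded at
    \<open>Suc i\<close>. A run starting at 0 has no change before it, so 0 is added by hand; this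
    is the 1 in \<open>Suc e\<close>.\<close>
  define D where "D = Suc ` ?G \<union> (if 0 \<in> B then {0} else {})"
  have fin: "finite ?G" by (rule finite_subset[of _ "{..<n}"]) auto
  have "card D \<le> card (Suc ` ?G) + card (if 0 \<in> B then {0::nat} else {})"
    unfolding D_def by (rule card_Un_le)
  also have "\<dots> \<le> Suc e" using c by (auto simp: card_image)
  finally have 1: "card D \<le> Suc e" .
  have 2: "D \<subseteq> {..<n}" using B by (auto simp: D_def)
  have "i < n \<Longrightarrow> i \<in> B \<longleftrightarrow> odd (card (D \<inter> {..i}))" for i
  proof (induction i)
    case 0
    have "D \<inter> {..0} = (if 0 \<in> B then {0} else {})" by (auto simp: D_def)
    then show ?case by simp
  next
    case (Suc i)
    have fD: "finite (D \<inter> {..i})" by simp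
    have "D \<inter> {..Suc i} = (if Suc i \<in> D then insert (Suc i) (D \<inter> {..i}) else D \<inter> {..i})"
      by (auto simp: le_Suc_eq)
    then have "card (D \<inter> {..Suc i}) = (if Suc i \<in> D then Suc (card (D \<inter> {..i})) else card (D \<inter> {..i}))"
      using fD by simp
    moreover have "Suc i \<in> D \<longleftrightarrow> (i \<in> B) \<noteq> (Suc i \<in> B)" using Suc.prems by (auto simp: D_def)
    moreover have "i \<in> B \<longleftrightarrow> odd (card (D \<inter> {..i}))" using Suc by simp
    ultimately show ?case by (cases "i \<in> B") simp_all
  qed
  with 1 2 that show thesis by blast
qed

text \<open>Outer bracket. Two neighbouring cells can differ in whether they meet \<open>A\<close>
  only if one of them contains a cut, so a cut in cell \<open>j\<close> explains at most the changes
  at \<open>j\<close> and \<open>j - 1\<close>. This gives \<open>2 * d\<close> changes, and 1 more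
  index for a run starting at cell 0.\<close>

lemma parity_approximation:
  fixes idx :: "real \<Rightarrow> nat"
  assumes idx: "mono idx" "range idx = {..<n}" and F: "cuts F A" "card F \<le> d"
  obtains D where "D \<subseteq> {..<n}" "card D \<le> 2 * d + 1"
    "\<And>x. idx x \<in> idx ` A \<longleftrightarrow> odd (card (D \<inter> {..idx x}))"
proof -
  have fin: "finite F" using F by (simp add: cuts_def)
  let ?G = "{i. Suc i < n \<and> (i \<in> idx ` A) \<noteq> (Suc i \<in> idx ` A)}"
  have "?G \<subseteq> idx ` F \<union> (\<lambda>f. idx f - 1) ` F"
  proof
    fix i assume i: "i \<in> ?G"
    show "i \<in> idx ` F \<union> (\<lambda>f. idx f - 1) ` F"
    proof (rule ccontr)
      assume "i \<notin> idx ` F \<union> (\<lambda>f. idx f - 1) ` F"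
      then have nF: "idx f \<noteq> i" "idx f \<noteq> Suc i" if "f \<in> F" for f
      proof -
        show "idx f \<noteq> i" using \<open>i \<notin> _\<close> that by blast
        have "idx f - 1 \<noteq> i" using \<open>i \<notin> _\<close> that by blast
        then show "idx f \<noteq> Suc i" by simp
      qed
      have eq: "x \<in> A \<longleftrightarrow> y \<in> A" if xy: "idx x = i" "idx y = Suc i" for x y
      proof -
        have "x < y"
        proof (rule ccontr)
          assume "\<not> x < y"
          then have "idx y \<le> idx x" by (intro monoD[OF idx(1)]) simp
          then show False using xy by simp
        qed
        moreover have "{x..y} \<inter> F = {}"
        proof (rule ccontr)
          assume "{x..y} \<inter> F \<noteq> {}"
          then obtain f where f: "f \<in> F" "x \<le> f" "f \<le> y" by auto
          then have "i \<le> idx f" "idx f \<le> Suc i"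
            using monoD[OF idx(1), of x f] monoD[OF idx(1), of f y] xy by auto
          then show False using nF[OF f(1)] by linarith
        qed
        ultimately show ?thesis using F(1) by (auto simp: cuts_def)
      qed
      \<comment> \<open>Both cells are nonempty, so the representatives \<open>x0\<close> and
        \<open>y0\<close> decide whether the cells meet \<open>A\<close>.\<close>
      have "i \<in> range idx" "Suc i \<in> range idx" using i idx(2) by auto
      then obtain x0 y0 where xy0: "idx x0 = i" "idx y0 = Suc i" unfolding image_iff by metis
      have "i \<in> idx ` A \<longleftrightarrow> x0 \<in> A" "Suc i \<in> idx ` A \<longleftrightarrow> y0 \<in> A"
        unfolding image_iff using eq xy0 by metis+
      then show False using i eq[OF xy0] by simp
    qed
  qed
  then have "card ?G \<le> card (idx ` F \<union> (\<lambda>f. idx f - 1) ` F)" by (intro card_mono) (use fin in auto)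
  also have "\<dots> \<le> card (idx ` F) + card ((\<lambda>f. idx f - 1) ` F)" by (rule card_Un_le)
  also have "\<dots> \<le> card F + card F" by (intro add_mono card_image_le fin)
  finally have G: "card ?G \<le> 2 * d" using F by simp
  have sub: "idx ` A \<subseteq> {..<n}" using idx by auto
  obtain D where D: "D \<subseteq> {..<n}" "card D \<le> Suc (2 * d)"
      "\<And>i. i < n \<Longrightarrow> i \<in> idx ` A \<longleftrightarrow> odd (card (D \<inter> {..i}))"
    by (rule parity_representation[OF sub G]) blast
  have "idx x < n" for x using idx(2) by auto
  with D show thesis by (intro that[of D]) simp_all
qed

text \<open>Inner bracket: the cells contained in \<open>A\<close> are those outside the outer
  bracket of the complement.\<close>

lemma parity_approximation_inner:
  fixes idx :: "real \<Rightarrow> nat"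
  assumes idx: "mono idx" "range idx = {..<n}" and F: "cuts F A" "card F \<le> d" and n: "1 \<le> n"
  obtains D where "D \<subseteq> {..<n}" "card D \<le> 2 * d + 2"
    "\<And>x. idx x \<notin> idx ` (- A) \<longleftrightarrow> odd (card (D \<inter> {..idx x}))"
proof -
  obtain D where D: "D \<subseteq> {..<n}" "card D \<le> 2 * d + 1"
    "\<And>x. idx x \<in> idx ` (- A) \<longleftrightarrow> odd (card (D \<inter> {..idx x}))"
    by (rule parity_approximation[OF idx cuts_Compl[OF F(1)] F(2)]) blast
  \<comment> \<open>Every prefix \<open>{..i}\<close> contains 0, so toggling 0 flips all parities
    and thereby complements the coded set.\<close>
  define D' where "D' = (if 0 \<in> D then D - {0} else insert 0 D)"
  have fin: "finite D" using D(1) finite_subset by blast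
  have "D' \<inter> {..i} = (if 0 \<in> D then (D \<inter> {..i}) - {0} else insert 0 (D \<inter> {..i}))" for i
    by (auto simp: D'_def)
  moreover have "odd (card (D \<inter> {..i} - {0})) \<longleftrightarrow> even (card (D \<inter> {..i}))" if "0 \<in> D" for i
  proof -
    have "card (D \<inter> {..i}) = Suc (card (D \<inter> {..i} - {0}))"
      using that fin by (intro card.remove) auto
    then show ?thesis by (metis even_Suc)
  qed
  ultimately have "odd (card (D' \<inter> {..i})) \<longleftrightarrow> even (card (D \<inter> {..i}))" for i
    by simp
  moreover have "D' \<subseteq> {..<n}" using D(1) n by (auto simp: D'_def)
  moreover have "card D' \<le> 2 * d + 2"
    using D(2) fin by (auto simp: D'_def card_Diff_singleton_if)
  ultimately show thesis using D(3) by (intro that[of D']) auto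
qed

text \<open>The Chernoff bound is imposed only on the finitely many parity sets. Any other
  \<open>A\<close> lies between two of them whose difference is covered by the at most
  \<open>d\<close> cells containing cuts, hence has mass at most \<open>d / n\<close>; the
  hypothesis \<open>d <= y\<close> absorbs this into the linear term.\<close>

lemma uniform_count_bound:
  assumes s: "s \<in> densities" and n: "1 \<le> n" and y: "0 < y" and d: "real d \<le> y"
  obtains Om where "Om \<in> sets (sample_measure n s)"
    "measure (sample_measure n s) (space (sample_measure n s) - Om)
       \<le> card {D. D \<subseteq> {..<n} \<and> card D \<le> 2 * d + 2} * (2 * exp (- y))"
    "\<And>X A F. X \<in> Om \<Longrightarrow> A \<in> sets borel \<Longrightarrow> cuts F A \<Longrightarrow> card F \<le> d \<Longrightarrow>
       \<bar>sample_count n A X - n * measure (law s) A\<bar> \<le> 2 * sqrt (n * measure (law s) A * y) + 5 * y"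
proof -
  interpret M: prob_space "sample_measure n s" by (rule prob_space_sample[OF s])
  interpret L: prob_space "law s" by (rule prob_space_law[OF s])
  obtain idx where idx: "mono idx" "range idx = {..<n}" "\<And>i. measure (law s) {x. idx x = i} \<le> 1 / n"
    using quantile_index[OF s n] by blast
  let ?D = "{D. D \<subseteq> {..<n} \<and> card D \<le> 2 * d + 2}"
  define par where "par D = {x. odd (card (D \<inter> {..idx x}))}" for D
  have par: "par D \<in> sets borel" for D
    using sets_index[OF idx(1), of "{i. odd (card (D \<inter> {..i}))}"] by (simp add: par_def)
  note [measurable] = par
  define bad where "bad D = {X \<in> space (sample_measure n s).
    2 * sqrt (n * measure (law s) (par D) * y) + 2 * y < \<bar>sample_count n (par D) X - n * measure (law s) (par D)\<bar>}" for D
  have bad[measurable]: "bad D \<in> sets (sample_measure n s)" for D unfolding bad_def by measurable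
  define Om where "Om = space (sample_measure n s) - (\<Union>D\<in>?D. bad D)"
  have finD: "finite ?D" by (rule finite_subset[of _ "Pow {..<n}"]) auto
  have Om: "Om \<in> sets (sample_measure n s)" unfolding Om_def using finD bad by (intro sets.Diff sets.finite_UN) auto
  have "space (sample_measure n s) - Om = (\<Union>D\<in>?D. bad D)" unfolding Om_def by (auto simp: bad_def)
  then have "measure (sample_measure n s) (space (sample_measure n s) - Om) \<le> (\<Sum>D\<in>?D. measure (sample_measure n s) (bad D))"
    using M.finite_measure_subadditive_finite[OF finD, of bad, OF image_subsetI[OF bad]] by simp
  also have "\<dots> \<le> (\<Sum>D\<in>?D. 2 * exp (- y))"
    unfolding bad_def by (intro sum_mono chernoff_two_sided s par y)
  finally have prob: "measure (sample_measure n s) (space (sample_measure n s) - Om) \<le> card ?D * (2 * exp (- y))"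
    by simp
  have "\<bar>sample_count n A X - n * measure (law s) A\<bar> \<le> 2 * sqrt (n * measure (law s) A * y) + 5 * y"
    if X: "X \<in> Om" and A: "A \<in> sets borel" and F: "cuts F A" "card F \<le> d" for X A F
  proof -
    have fin: "finite F" using F by (simp add: cuts_def)
    obtain D1 where D1: "D1 \<subseteq> {..<n}" "card D1 \<le> 2 * d + 1"
      "\<And>x. idx x \<in> idx ` A \<longleftrightarrow> odd (card (D1 \<inter> {..idx x}))"
      by (rule parity_approximation[OF idx(1,2) F]) blast
    obtain D2 where D2: "D2 \<subseteq> {..<n}" "card D2 \<le> 2 * d + 2"
      "\<And>x. idx x \<notin> idx ` (- A) \<longleftrightarrow> odd (card (D2 \<inter> {..idx x}))"
      by (rule parity_approximation_inner[OF idx(1,2) F n]) blast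
    have eq1: "par D1 = {x. idx x \<in> idx ` A}" using D1(3) by (auto simp: par_def)
    have eq2: "par D2 = {x. idx x \<notin> idx ` (- A)}" using D2(3) by (auto simp: par_def)
    have sub1: "A \<subseteq> par D1" and sub2: "par D2 \<subseteq> A" unfolding eq1 eq2 by auto
    \<comment> \<open>A cell in the outer but not in the inner bracket meets both \<open>A\<close>
      and its complement, so a cut lies between two of its points, and by monotonicity of
      \<open>idx\<close> in that cell.\<close>
    have dif: "par D1 - par D2 \<subseteq> (\<Union>i\<in>idx ` F. {x. idx x = i})"
    proof
      fix x assume x: "x \<in> par D1 - par D2"
      then obtain u v where uv: "u \<in> A" "idx u = idx x" "v \<notin> A" "idx v = idx x"
        unfolding eq1 eq2 by (auto dest: sym)
      have "{min u v..max u v} \<inter> F \<noteq> {}"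
      proof
        assume e: "{min u v..max u v} \<inter> F = {}"
        have "min u v < max u v" using uv by (cases u v rule: linorder_cases) auto
        then have "min u v \<in> A \<longleftrightarrow> max u v \<in> A" using F(1) e by (simp add: cuts_def)
        then show False using uv by (auto simp: min_def max_def split: if_splits)
      qed
      then obtain f where f: "f \<in> F" "min u v \<le> f" "f \<le> max u v" by auto
      then have "idx (min u v) \<le> idx f" "idx f \<le> idx (max u v)" using idx(1) by (auto dest: monoD)
      moreover have "idx (min u v) = idx x" "idx (max u v) = idx x" using uv by (auto simp: min_def max_def)
      ultimately have "idx x = idx f" by simp
      then show "x \<in> (\<Union>i\<in>idx ` F. {x. idx x = i})" using f(1) by blast
    qed
    define p p1 p2 where "p = measure (law s) A" and "p1 = measure (law s) (par D1)" and "p2 = measure (law s) (par D2)"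
    have cell: "{x. idx x = i} \<in> sets borel" for i using sets_index[OF idx(1), of "{i}"] by simp
    have "measure (law s) (par D1 - par D2) \<le> measure (law s) (\<Union>i\<in>idx ` F. {x. idx x = i})"
      using fin cell by (intro L.finite_measure_mono dif) auto
    also have "\<dots> \<le> (\<Sum>i\<in>idx ` F. measure (law s) {x. idx x = i})"
      using fin cell by (intro L.finite_measure_subadditive_finite) auto
    also have "\<dots> \<le> (\<Sum>i\<in>idx ` F. 1 / n)" by (intro sum_mono idx(3))
    also have "\<dots> = card (idx ` F) / n" by simp
    also have "\<dots> \<le> d / n"
      using card_image_le[OF fin, of idx] F(2) by (intro divide_right_mono) auto
    finally have "p1 - p2 \<le> d / n"
      using sub1 sub2 par by (subst (asm) L.finite_measure_Diff) (auto simp: p1_def p2_def)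
    then have "n * (p1 - p2) \<le> d" using n by (simp add: field_simps)
    then have diff: "n * p1 \<le> n * p2 + y" using d by (simp add: algebra_simps)
    have pp: "p \<le> p1" "p2 \<le> p" "0 \<le> p2"
      unfolding p_def p1_def p2_def using sub1 sub2 par A by (auto intro!: L.finite_measure_mono)
    have npp: "n * p \<le> n * p1" "n * p2 \<le> n * p" "0 \<le> n * p2" using pp by (auto intro: mult_left_mono)
    have b1: "\<bar>sample_count n (par D1) X - n * p1\<bar> \<le> 2 * sqrt (n * p1 * y) + 2 * y"
    proof -
      have "X \<notin> bad D1" "X \<in> space (sample_measure n s)" using X D1(1,2) by (auto simp: Om_def)
      then show ?thesis by (auto simp: bad_def p1_def)
    qed
    have b2: "\<bar>sample_count n (par D2) X - n * p2\<bar> \<le> 2 * sqrt (n * p2 * y) + 2 * y"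
    proof -
      have "X \<notin> bad D2" "X \<in> space (sample_measure n s)" using X D2(1,2) by (auto simp: Om_def)
      then show ?thesis by (auto simp: bad_def p2_def)
    qed
    have c: "sample_count n A X \<le> sample_count n (par D1) X" "sample_count n (par D2) X \<le> sample_count n A X"
      using sub1 sub2 by (intro sum_mono; auto simp: indicator_def)+
    have "sqrt (n * p1 * y) \<le> sqrt (n * p * y + y\<^sup>2)"
    proof -
      have "n * p1 * y \<le> (n * p + y) * y" using diff npp y by (intro mult_right_mono) auto
      then show ?thesis by (simp add: algebra_simps power2_eq_square)
    qed
    also have "\<dots> \<le> sqrt (n * p * y) + sqrt (y\<^sup>2)"
      using npp y by (intro sqrt_add_le_add_sqrt) auto
    finally have r1: "sqrt (n * p1 * y) \<le> sqrt (n * p * y) + y" using y by simp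
    have r2: "sqrt (n * p2 * y) \<le> sqrt (n * p * y)" using npp y by (simp add: mult_right_mono)
    \<comment> \<open>Of the \<open>5 * y\<close>, 2 come from the Chernoff bound, 2 from replacing
      \<open>p1\<close> by \<open>p\<close> under the root, and 1 from
      \<open>n * (p1 - p)\<close>.\<close>
    have "sample_count n A X - n * p \<le> 2 * sqrt (n * p * y) + 5 * y"
      using b1 c(1) r1 diff npp by linarith
    moreover have "- (sample_count n A X - n * p) \<le> 2 * sqrt (n * p * y) + 5 * y"
      using b2 c(2) r2 diff npp y by linarith
    ultimately show ?thesis unfolding p_def by linarith
  qed
  with Om prob that show thesis by blast
qed

section \<open>From level sets to functions\<close>

text \<open>The number of levels below \<open>v\<close> is \<open>m = floor (M * v)\<close>, so the
  staircase is \<open>m / M\<close>. The weighted sum is \<open>m * (m + 1) / 2\<close>, at most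
  \<open>m^2\<close>.\<close>

lemma level_sum:
  fixes v :: real and M :: nat
  assumes v: "0 \<le> v" "v \<le> 1" and M: "1 \<le> M"
  shows "(\<Sum>j=1..M. of_bool (j / M \<le> v)) / M \<le> v"
    and "v \<le> (\<Sum>j=1..M. of_bool (j / M \<le> v)) / M + 1 / M"
    and "(\<Sum>j=1..M. real j * of_bool (j / M \<le> v)) \<le> (M * v)\<^sup>2"
proof -
  define m where "m = nat \<lfloor>M * v\<rfloor>"
  have m: "real m \<le> M * v" "M * v < real m + 1" using v by (auto simp: m_def)
  have "M * v \<le> real M * 1" using v by (intro mult_left_mono) auto
  then have mM: "m \<le> M" using m by linarith
  have iff: "real j / M \<le> v \<longleftrightarrow> j \<le> m" for j :: nat
  proof -
    have "real j / M \<le> v \<longleftrightarrow> real j \<le> M * v" using M by (simp add: field_simps)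
    also have "\<dots> \<longleftrightarrow> j \<le> m" using m by linarith
    finally show ?thesis .
  qed
  have S: "(\<Sum>j=1..M. f j * of_bool (j / M \<le> v)) = (\<Sum>j=1..m. f j)" for f :: "nat \<Rightarrow> real"
  proof -
    have "(\<Sum>j=1..M. f j * of_bool (j / M \<le> v)) = (\<Sum>j\<in>{1..M}. if j \<le> m then f j else 0)"
      unfolding iff by (intro sum.cong) auto
    also have "\<dots> = (\<Sum>j\<in>{1..M} \<inter> {j. j \<le> m}. f j)" by (simp add: sum.inter_restrict)
    also have "{1..M} \<inter> {j. j \<le> m} = {1..m}" using mM by auto
    finally show ?thesis .
  qed
  have S1: "(\<Sum>j=1..M. of_bool (j / M \<le> v)) = real m" using S[of "\<lambda>_. 1"] by simp
  show "(\<Sum>j=1..M. of_bool (j / M \<le> v)) / M \<le> v" unfolding S1 using m M by (simp add: field_simps)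
  show "v \<le> (\<Sum>j=1..M. of_bool (j / M \<le> v)) / M + 1 / M" unfolding S1 using m M by (simp add: field_simps)
  have "(\<Sum>j=1..m. real j) = real m * (real m + 1) / 2" by (induction m) (auto simp: field_simps)
  also have "\<dots> \<le> (real m)\<^sup>2" by (cases m) (auto simp: power2_eq_square field_simps)
  also have "\<dots> \<le> (M * v)\<^sup>2" using m by (intro power_mono) auto
  finally show "(\<Sum>j=1..M. real j * of_bool (j / M \<le> v)) \<le> (M * v)\<^sup>2" unfolding S .
qed

text \<open>Deterministic: \<open>X\<close> is fixed and randomness enters only through
  \<open>dev\<close>. Replacing \<open>g\<close> by its staircase costs \<open>n / M\<close>. Since
  the sum of \<open>j * P (g >= j / M)\<close> is at most \<open>M^2\<close> times the second moment
  of \<open>g\<close>, square-root deviations of the levels can be charged to that moment.\<close>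

lemma layered_deviation:
  fixes g :: "real \<Rightarrow> real" and M :: nat
  assumes s: "s \<in> densities" and g[measurable]: "g \<in> borel_measurable borel"
    and g01: "\<And>x. 0 \<le> g x" "\<And>x. g x \<le> 1" and M: "1 \<le> M" and y: "0 \<le> y" and dl: "0 < \<delta>"
    and dev: "\<And>c. 0 < c \<Longrightarrow> \<bar>sample_count n {x. c \<le> g x} X - n * measure (law s) {x. c \<le> g x}\<bar>
        \<le> 2 * sqrt (n * measure (law s) {x. c \<le> g x} * y) + 5 * y"
  shows "\<bar>(\<Sum>i=1..n. g (X i)) - n * (\<integral>x. g x \<partial>law s)\<bar>
      \<le> n / M + 5 * y + y / \<delta> * harm M + \<delta> * n * (\<integral>x. (g x)\<^sup>2 \<partial>law s)"
proof -
  interpret L: prob_space "law s" by (rule prob_space_law[OF s])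
  define A where "A j = {x. real j / M \<le> g x}" for j :: nat
  have A[measurable]: "A j \<in> sets borel" for j unfolding A_def by measurable
  define P where "P j = measure (law s) (A j)" for j
  define C where "C j = sample_count n (A j) X" for j
  define gM where "gM x = (\<Sum>j=1..M. indicator (A j) x) / M" for x :: real
  have gM_alt: "gM x = (\<Sum>j=1..M. of_bool (j / M \<le> g x)) / M" for x
    unfolding gM_def by (intro arg_cong2[where f="(/)"] sum.cong refl) (auto simp: A_def indicator_def)
  have lo: "gM x \<le> g x" and hi: "g x \<le> gM x + 1 / M" for x
    unfolding gM_alt by (intro level_sum g01 M)+
  have ind_int: "integrable (law s) (\<lambda>x. indicator (A j) x :: real)" for j
    by (intro integrable_real_indicator) (auto simp: L.emeasure_eq_measure)
  have ind_val: "(\<integral>x. indicator (A j) x \<partial>law s) = P j" for j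
    by (simp add: P_def)
  have gM_int: "integrable (law s) gM"
    unfolding gM_def by (intro integrable_divide Bochner_Integration.integrable_sum ind_int)
  have gM_val: "(\<integral>x. gM x \<partial>law s) = (\<Sum>j=1..M. P j) / M"
    unfolding gM_def by (subst integral_divide_zero, subst Bochner_Integration.integral_sum[OF ind_int]) (simp only: ind_val)
  have g_int: "integrable (law s) g"
    using g01 by (intro L.integrable_const_bound[where B=1]) auto
  have g2_int: "integrable (law s) (\<lambda>x. (g x)\<^sup>2)"
    using g01 by (intro L.integrable_const_bound[where B=1]) (auto simp: power_le_one)
  have I1: "(\<Sum>j=1..M. P j) / M \<le> (\<integral>x. g x \<partial>law s)"
    unfolding gM_val[symmetric] by (intro integral_mono gM_int g_int lo)
  have "(\<integral>x. g x \<partial>law s) \<le> (\<integral>x. gM x + 1 / M \<partial>law s)"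
    by (intro integral_mono gM_int g_int hi Bochner_Integration.integrable_add L.integrable_const)
  also have "\<dots> = (\<Sum>j=1..M. P j) / M + 1 / M"
    using gM_int gM_val L.prob_space[simplified] by (subst Bochner_Integration.integral_add) auto
  finally have I2: "(\<integral>x. g x \<partial>law s) \<le> (\<Sum>j=1..M. P j) / M + 1 / M" .
  have sum_gM: "(\<Sum>i=1..n. gM (X i)) = (\<Sum>j=1..M. C j) / M"
    unfolding gM_def C_def sum_divide_distrib[symmetric] by (subst sum.swap) (rule refl)
  have S1: "(\<Sum>j=1..M. C j) / M \<le> (\<Sum>i=1..n. g (X i))"
    unfolding sum_gM[symmetric] by (intro sum_mono lo)
  have "(\<Sum>i=1..n. g (X i)) \<le> (\<Sum>i=1..n. gM (X i) + 1 / M)" by (intro sum_mono hi)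
  also have "\<dots> = (\<Sum>j=1..M. C j) / M + n / M" unfolding sum.distrib sum_gM by simp
  finally have S2: "(\<Sum>i=1..n. g (X i)) \<le> (\<Sum>j=1..M. C j) / M + n / M" .
  have nI1: "n * ((\<Sum>j=1..M. P j) / M) \<le> n * (\<integral>x. g x \<partial>law s)" using I1 by (intro mult_left_mono) auto
  have nI2: "n * (\<integral>x. g x \<partial>law s) \<le> n * ((\<Sum>j=1..M. P j) / M) + n / M"
    using mult_left_mono[OF I2, of n] by (simp add: algebra_simps)
  have main: "\<bar>(\<Sum>i=1..n. g (X i)) - n * (\<integral>x. g x \<partial>law s)\<bar>
     \<le> \<bar>(\<Sum>j=1..M. C j) / M - n * ((\<Sum>j=1..M. P j) / M)\<bar> + n / M"
    using S1 S2 nI1 nI2 by linarith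
  have second_moment: "(\<Sum>j=1..M. real j * P j) \<le> real M * real M * (\<integral>x. (g x)\<^sup>2 \<partial>law s)"
  proof -
    have "(\<Sum>j=1..M. real j * P j) = (\<integral>x. (\<Sum>j=1..M. real j * indicator (A j) x) \<partial>law s)"
      by (subst Bochner_Integration.integral_sum) (auto intro!: integrable_mult_right ind_int simp: P_def)
    also have "\<dots> \<le> (\<integral>x. (M * g x)\<^sup>2 \<partial>law s)"
    proof (rule integral_mono)
      show "integrable (law s) (\<lambda>x. \<Sum>j=1..M. real j * indicator (A j) x)"
        by (intro Bochner_Integration.integrable_sum integrable_mult_right ind_int)
      show "integrable (law s) (\<lambda>x. (M * g x)\<^sup>2)"
        unfolding power_mult_distrib by (intro integrable_mult_right g2_int)
      fix x
      have "(\<Sum>j=1..M. real j * indicator (A j) x) = (\<Sum>j=1..M. real j * of_bool (j / M \<le> g x))"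
        by (intro sum.cong refl) (auto simp: A_def indicator_def)
      also have "\<dots> \<le> (M * g x)\<^sup>2" by (intro level_sum g01 M)
      finally show "(\<Sum>j=1..M. real j * indicator (A j) x) \<le> (M * g x)\<^sup>2" .
    qed
    also have "\<dots> = real M * real M * (\<integral>x. (g x)\<^sup>2 \<partial>law s)"
      by (simp add: power_mult_distrib power2_eq_square[of "real M"])
    finally show ?thesis .
  qed
  have "\<bar>(\<Sum>j=1..M. C j) - n * (\<Sum>j=1..M. P j)\<bar> = \<bar>\<Sum>j=1..M. C j - n * P j\<bar>"
    by (simp add: sum_subtractf sum_distrib_left)
  also have "\<dots> \<le> (\<Sum>j=1..M. \<bar>C j - n * P j\<bar>)" by (rule sum_abs)
  also have "\<dots> \<le> (\<Sum>j=1..M. \<delta> * n / M * (real j * P j) + M * (y / \<delta>) * inverse j + 5 * y)"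
  proof (rule sum_mono)
    fix j assume j: "j \<in> {1..M}"
    \<comment> \<open>AM-GM with ratio \<open>\<delta> j / M\<close>: the parts \<open>a\<close> add up to the second moment of \<open>g\<close>, the parts \<open>b\<close> to a
      harmonic sum.\<close>
    define a b where "a = \<delta> * n / M * (real j * P j)" and "b = M * (y / \<delta>) * inverse (real j)"
    have ab: "0 \<le> a" "0 \<le> b" using dl y by (auto simp: a_def b_def P_def)
    have eq: "a * b = n * P j * y" using j M dl by (simp add: a_def b_def field_simps)
    have "2 * sqrt (a * b) \<le> a + b" using arith_geo_mean_sqrt[OF ab] by simp
    moreover have "\<bar>C j - n * P j\<bar> \<le> 2 * sqrt (n * P j * y) + 5 * y"
      using dev[of "real j / M"] j M by (simp add: C_def P_def A_def del: sum_indicator_eq_card)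
    ultimately show "\<bar>C j - n * P j\<bar> \<le> \<delta> * n / M * (real j * P j) + M * (y / \<delta>) * inverse j + 5 * y"
      unfolding eq by (simp add: a_def b_def)
  qed
  also have "\<dots> = \<delta> * n / M * (\<Sum>j=1..M. real j * P j) + M * (y / \<delta>) * harm M + M * (5 * y)"
    unfolding sum.distrib sum_distrib_left[symmetric] harm_def by simp
  also have "\<dots> \<le> \<delta> * n / M * (real M * real M * (\<integral>x. (g x)\<^sup>2 \<partial>law s)) + M * (y / \<delta>) * harm M + M * (5 * y)"
    using dl by (intro add_mono mult_left_mono second_moment order_refl) simp
  also have "\<dots> = M * (\<delta> * n * (\<integral>x. (g x)\<^sup>2 \<partial>law s) + y / \<delta> * harm M + 5 * y)"
    using M by (simp add: algebra_simps)
  finally have *: "\<bar>(\<Sum>j=1..M. C j) - n * (\<Sum>j=1..M. P j)\<bar> / M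
      \<le> \<delta> * n * (\<integral>x. (g x)\<^sup>2 \<partial>law s) + y / \<delta> * harm M + 5 * y"
    using M by (simp add: divide_le_eq mult.commute)
  have "\<bar>(\<Sum>j=1..M. C j) / M - n * ((\<Sum>j=1..M. P j) / M)\<bar> = \<bar>(\<Sum>j=1..M. C j) - n * (\<Sum>j=1..M. P j)\<bar> / M"
  proof -
    have "(\<Sum>j=1..M. C j) / M - n * ((\<Sum>j=1..M. P j) / M) = ((\<Sum>j=1..M. C j) - n * (\<Sum>j=1..M. P j)) / M"
      by (simp add: diff_divide_distrib)
    then show ?thesis by (simp add: abs_divide)
  qed
  with main * show ?thesis by linarith
qed

text \<open>The positive and negative parts of \<open>g\<close> have disjoint supports, so their
  squares add up to \<open>g^2\<close>. Only the remainder is doubled, while the coefficient of the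
  second moment, which must stay small, is not.\<close>

lemma layered_deviation_signed:
  fixes g :: "real \<Rightarrow> real" and M :: nat
  assumes s: "s \<in> densities" and g[measurable]: "g \<in> borel_measurable borel"
    and g1: "\<And>x. \<bar>g x\<bar> \<le> 1" and M: "1 \<le> M" and y: "0 \<le> y" and dl: "0 < \<delta>"
    and dev: "\<And>c A. 0 < c \<Longrightarrow> A = {x. c \<le> g x} \<or> A = {x. c \<le> - g x} \<Longrightarrow>
        \<bar>sample_count n A X - n * measure (law s) A\<bar> \<le> 2 * sqrt (n * measure (law s) A * y) + 5 * y"
  shows "\<bar>(\<Sum>i=1..n. g (X i)) - n * (\<integral>x. g x \<partial>law s)\<bar>
      \<le> 2 * (n / M + 5 * y + y / \<delta> * harm M) + \<delta> * n * (\<integral>x. (g x)\<^sup>2 \<partial>law s)"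
proof -
  interpret L: prob_space "law s" by (rule prob_space_law[OF s])
  define u v where "u x = max (g x) 0" and "v x = max (- g x) 0" for x
  have [measurable]: "u \<in> borel_measurable borel" "v \<in> borel_measurable borel"
    unfolding u_def v_def by measurable
  have b: "0 \<le> u x" "u x \<le> 1" "0 \<le> v x" "v x \<le> 1" "g x = u x - v x" "(g x)\<^sup>2 = (u x)\<^sup>2 + (v x)\<^sup>2" for x
    using g1[of x] by (auto simp: u_def v_def max_def)
  have lev: "{x. c \<le> u x} = {x. c \<le> g x}" "{x. c \<le> v x} = {x. c \<le> - g x}" if "0 < c" for c
    using that by (auto simp: u_def v_def)
  have U: "\<bar>(\<Sum>i=1..n. u (X i)) - n * (\<integral>x. u x \<partial>law s)\<bar>
      \<le> n / M + 5 * y + y / \<delta> * harm M + \<delta> * n * (\<integral>x. (u x)\<^sup>2 \<partial>law s)"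
    by (rule layered_deviation[OF s _ _ _ M y dl]) (use dev lev b in auto)
  have V: "\<bar>(\<Sum>i=1..n. v (X i)) - n * (\<integral>x. v x \<partial>law s)\<bar>
      \<le> n / M + 5 * y + y / \<delta> * harm M + \<delta> * n * (\<integral>x. (v x)\<^sup>2 \<partial>law s)"
    by (rule layered_deviation[OF s _ _ _ M y dl]) (use dev lev b in auto)
  have i: "integrable (law s) u" "integrable (law s) v"
    using b by (auto intro!: L.integrable_const_bound[where B=1])
  have i2: "integrable (law s) (\<lambda>x. (u x)\<^sup>2)" "integrable (law s) (\<lambda>x. (v x)\<^sup>2)"
    using b by (auto intro!: L.integrable_const_bound[where B=1] simp: power_le_one)
  have e1: "(\<integral>x. g x \<partial>law s) = (\<integral>x. u x \<partial>law s) - (\<integral>x. v x \<partial>law s)" using i by (simp add: b(5))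
  have e2: "(\<integral>x. (g x)\<^sup>2 \<partial>law s) = (\<integral>x. (u x)\<^sup>2 \<partial>law s) + (\<integral>x. (v x)\<^sup>2 \<partial>law s)" using i2 by (simp add: b(6))
  have e3: "(\<Sum>i=1..n. g (X i)) = (\<Sum>i=1..n. u (X i)) - (\<Sum>i=1..n. v (X i))" by (simp add: b(5) sum_subtractf)
  have comb: "\<bar>(a - c) - (b - d)\<bar> \<le> 2 * K + (p + q)"
    if "\<bar>a - b\<bar> \<le> K + p" "\<bar>c - d\<bar> \<le> K + q" for a b c d K p q :: real
    using that by linarith
  show ?thesis unfolding e1 e2 e3 distrib_left[of "\<delta> * n"] right_diff_distrib by (rule comb[OF U V])
qed

lemma harm_le_ln:
  assumes "1 \<le> M" shows "harm M \<le> 1 + ln (real M)"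
proof -
  obtain m where m: "M = Suc m" using assms by (cases M) auto
  have "harm (Suc m) - ln (real (Suc m)) \<le> harm (Suc 0) - ln (real (Suc 0))"
    using decseqD[OF decseq_harm_diff_ln, of 0 m] by simp
  then show ?thesis by (simp add: m harm_expand(2))
qed

section \<open>Cuts of piecewise monotone functions\<close>

text \<open>The cut is the infimum or supremum of the superlevel set \<open>U\<close> within
  \<open>J\<close>. It may be an arbitrary default real if \<open>U\<close> is empty or unbounded,
  but a change of membership between \<open>x\<close> and \<open>y\<close> forces \<open>U\<close>
  to be nonempty and bounded on the relevant side.\<close>

lemma monotone_level_cut:
  fixes g :: "real \<Rightarrow> real"
  assumes "mono_on J g \<or> antimono_on J g"
  obtains b where "\<And>x y. x \<in> J \<Longrightarrow> y \<in> J \<Longrightarrow> x < y \<Longrightarrow> b \<notin> {x..y} \<Longrightarrow> c \<le> g x \<longleftrightarrow> c \<le> g y"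
proof (cases "mono_on J g")
  case True
  define U where "U = {x \<in> J. c \<le> g x}"
  show thesis
  proof (rule that[of "Inf U"])
    fix x y assume xy: "x \<in> J" "y \<in> J" "x < y" "Inf U \<notin> {x..y}"
    have "g x \<le> g y" using True xy by (auto intro: mono_onD)
    moreover have False if n: "\<not> c \<le> g x" "c \<le> g y"
    proof -
      have low: "x \<le> z" if "z \<in> U" for z
      proof (rule ccontr)
        assume "\<not> x \<le> z"
        then have "g z \<le> g x" using True xy that by (auto simp: U_def intro: mono_onD)
        then show False using n that by (auto simp: U_def)
      qed
      have yU: "y \<in> U" using n xy by (simp add: U_def)
      have "x \<le> Inf U" using low yU by (intro cInf_greatest) auto
      moreover have "Inf U \<le> y" using low yU by (intro cInf_lower bdd_belowI[of U x])
      ultimately show False using xy by simp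
    qed
    ultimately show "c \<le> g x \<longleftrightarrow> c \<le> g y" by (meson order_trans)
  qed
next
  case False
  then have anti: "antimono_on J g" using assms by simp
  have antiD: "g z \<le> g x" if "x \<in> J" "z \<in> J" "x \<le> z" for x z
    using anti that by (auto simp: monotone_on_def)
  define U where "U = {x \<in> J. c \<le> g x}"
  show thesis
  proof (rule that[of "Sup U"])
    fix x y assume xy: "x \<in> J" "y \<in> J" "x < y" "Sup U \<notin> {x..y}"
    have "g y \<le> g x" using antiD xy by auto
    moreover have False if n: "c \<le> g x" "\<not> c \<le> g y"
    proof -
      have up: "z \<le> y" if "z \<in> U" for z
      proof (rule ccontr)
        assume "\<not> z \<le> y"
        then have "g z \<le> g y" using antiD xy that by (auto simp: U_def)
        then show False using n that by (auto simp: U_def)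
      qed
      have xU: "x \<in> U" using n xy by (simp add: U_def)
      have "Sup U \<le> y" using up xU by (intro cSup_least) auto
      moreover have "x \<le> Sup U" using up xU by (intro cSup_upper bdd_aboveI[of U y])
      ultimately show False using xy by simp
    qed
    ultimately show "c \<le> g x \<longleftrightarrow> c \<le> g y" by (meson order_trans)
  qed
qed

text \<open>Quantifying over all intervals avoiding \<open>F\<close> replaces an ordered list of
  pieces: refining is a union of exceptional sets, without sorting endpoints, and the values at
  points of \<open>F\<close> stay free.\<close>

definition piecewise_monotone_off :: "real set \<Rightarrow> (real \<Rightarrow> real) \<Rightarrow> bool" where
  "piecewise_monotone_off F g \<longleftrightarrow> finite F \<and>
     (\<forall>J. is_interval J \<longrightarrow> J \<inter> F = {} \<longrightarrow> mono_on J g \<or> antimono_on J g)"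

lemma piecewise_monotone_offD:
  assumes "piecewise_monotone_off F g"
  shows "finite F" "is_interval J \<Longrightarrow> J \<inter> F = {} \<Longrightarrow> mono_on J g \<or> antimono_on J g"
  using assms unfolding piecewise_monotone_off_def by simp_all

lemma piecewise_monotone_offI:
  assumes "finite F" "\<And>J. is_interval J \<Longrightarrow> J \<inter> F = {} \<Longrightarrow> mono_on J g \<or> antimono_on J g"
  shows "piecewise_monotone_off F g"
  using assms unfolding piecewise_monotone_off_def by simp

text \<open>The number of points of \<open>F\<close> below \<open>x\<close> labels the gaps of
  \<open>F\<close>. There are at most \<open>card F + 1\<close> gaps, each contributing one cut
  besides the points of \<open>F\<close> themselves.\<close>

lemma level_set_cuts:
  assumes g: "piecewise_monotone_off F g"
  obtains G where "cuts G {x. c \<le> g x}" "card G \<le> 2 * card F + 1"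
proof -
  have fin: "finite F" using g by (simp add: piecewise_monotone_off_def)
  define r where "r x = card {f \<in> F. f < x}" for x
  have r_le: "r x \<le> card F" for x unfolding r_def by (intro card_mono fin) auto
  have free: "f \<notin> F" if "r x = r y" "x \<le> f" "f < y" for x y f
  proof
    assume "f \<in> F"
    have "f \<in> {f \<in> F. f < y}" "f \<notin> {f \<in> F. f < x}" using \<open>f \<in> F\<close> that by auto
    moreover have "{f \<in> F. f < x} \<subseteq> {f \<in> F. f < y}" using that by auto
    ultimately have "{f \<in> F. f < x} \<subset> {f \<in> F. f < y}" by blast
    then have "r x < r y" unfolding r_def using fin by (intro psubset_card_mono) auto
    then show False using that by simp
  qed
  define J where "J i = {x. x \<notin> F \<and> r x = i}" for i
  have mono: "mono_on (J i) g \<or> antimono_on (J i) g" for i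
  proof -
    have "is_interval (J i)" unfolding is_interval_1
    proof (intro ballI allI impI)
      fix a b x assume ab: "a \<in> J i" "b \<in> J i" and x: "a \<le> x \<and> x \<le> b"
      have "x \<notin> F" using free[of a b x] ab x by (cases "x = b") (auto simp: J_def)
      moreover have "r a \<le> r x" "r x \<le> r b"
        unfolding r_def using x fin by (auto intro!: card_mono)
      ultimately show "x \<in> J i" using ab by (auto simp: J_def)
    qed
    moreover have "J i \<inter> F = {}" by (auto simp: J_def)
    ultimately show ?thesis using g by (simp add: piecewise_monotone_off_def)
  qed
  define b where "b i = (SOME b. \<forall>x\<in>J i. \<forall>y\<in>J i. x < y \<longrightarrow> b \<notin> {x..y} \<longrightarrow> (c \<le> g x \<longleftrightarrow> c \<le> g y))" for i
  have b: "\<forall>x\<in>J i. \<forall>y\<in>J i. x < y \<longrightarrow> b i \<notin> {x..y} \<longrightarrow> (c \<le> g x \<longleftrightarrow> c \<le> g y)" for i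
    unfolding b_def
  proof (rule someI_ex)
    obtain b where "\<And>x y. x \<in> J i \<Longrightarrow> y \<in> J i \<Longrightarrow> x < y \<Longrightarrow> b \<notin> {x..y} \<Longrightarrow> c \<le> g x \<longleftrightarrow> c \<le> g y"
      by (rule monotone_level_cut[OF mono]) blast
    then show "\<exists>b. \<forall>x\<in>J i. \<forall>y\<in>J i. x < y \<longrightarrow> b \<notin> {x..y} \<longrightarrow> (c \<le> g x \<longleftrightarrow> c \<le> g y)" by blast
  qed
  define G where "G = F \<union> b ` {..card F}"
  have "c \<le> g x \<longleftrightarrow> c \<le> g y" if xy: "x < y" "{x..y} \<inter> G = {}" for x y
  proof -
    have nF: "f \<notin> F" if "x \<le> f" "f \<le> y" for f using xy(2) that by (auto simp: G_def)
    have "{f \<in> F. f < x} = {f \<in> F. f < y}"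
    proof (intro set_eqI iffI)
      fix f assume f: "f \<in> {f \<in> F. f < y}"
      then have "\<not> x \<le> f" using nF[of f] by auto
      then show "f \<in> {f \<in> F. f < x}" using f by auto
    qed (use xy(1) in auto)
    then have "r x = r y" unfolding r_def by (rule arg_cong)
    moreover have "x \<notin> F" "y \<notin> F" using nF xy(1) by auto
    ultimately have J: "x \<in> J (r x)" "y \<in> J (r x)" by (simp_all add: J_def)
    have "b (r x) \<in> G" using r_le[of x] by (simp add: G_def)
    then have nb: "b (r x) \<notin> {x..y}" using xy(2) by blast
    show ?thesis by (rule b[rule_format, OF J xy(1) nb])
  qed
  moreover have "finite G" unfolding G_def using fin by simp
  ultimately have "cuts G {x. c \<le> g x}" unfolding cuts_def mem_Collect_eq by blast
  moreover have "card G \<le> 2 * card F + 1"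
  proof -
    have "card G \<le> card F + card (b ` {..card F})" unfolding G_def by (rule card_Un_le)
    also have "card (b ` {..card F}) \<le> card {..card F}" by (rule card_image_le) simp
    finally show ?thesis by simp
  qed
  ultimately show thesis by (rule that)
qed

lemma piecewise_monotone_off_uminus:
  assumes "piecewise_monotone_off F g" shows "piecewise_monotone_off F (\<lambda>x. - g x)"
proof -
  have "mono_on J (\<lambda>x. - g x) \<or> antimono_on J (\<lambda>x. - g x)"
    if "mono_on J g \<or> antimono_on J g" for J
    using that by (auto simp: monotone_on_def)
  then show ?thesis using assms unfolding piecewise_monotone_off_def by blast
qed

lemma piecewise_monotone_density_cuts:
  assumes t: "t \<in> piecewise_monotone_densities k"
  obtains F where "piecewise_monotone_off F t" "card F \<le> k - 1"
proof -
  obtain x :: "nat \<Rightarrow> ereal" where x: "x 0 = -\<infinity>" "x k = \<infinity>" "\<And>j. j < k \<Longrightarrow> x j < x (Suc j)"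
    and m: "\<And>j. j < k \<Longrightarrow> mono_on (einterval (x j) (x (Suc j))) t \<or> antimono_on (einterval (x j) (x (Suc j))) t"
    using t unfolding piecewise_monotone_densities_def interval_partitions_def by auto
  define F where "F = (\<lambda>j. real_of_ereal (x j)) ` {1..<k}"
  have "card F \<le> card {1..<k}" unfolding F_def by (rule card_image_le) simp
  then have card: "card F \<le> k - 1" by simp
  have inF: "z \<in> F" if "x j = ereal z" "j \<le> k" for j z
  proof -
    have "j \<noteq> 0" "j \<noteq> k" using that x(1,2) by (metis MInfty_neq_ereal(1), metis PInfty_neq_ereal(1))
    then have "j \<in> {1..<k}" using that by auto
    moreover have "real_of_ereal (x j) = z" using that by simp
    ultimately show ?thesis unfolding F_def by blast
  qed
  have "mono_on J t \<or> antimono_on J t" if J: "is_interval J" "J \<inter> F = {}" for J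
  proof (cases "J = {}")
    case True then show ?thesis by (simp add: monotone_on_def)
  next
    case False
    then obtain z where z: "z \<in> J" by auto
    \<comment> \<open>The half-open form gives every real \<open>z\<close> a piece. Equality at the
      right end is ruled out below, because that endpoint would lie in both \<open>J\<close> and
      \<open>F\<close>.\<close>
    have "\<exists>j<k. x j < ereal z \<and> ereal z \<le> x (Suc j)"
    proof -
      have "\<exists>j<m. x j < ereal z \<and> ereal z \<le> x (Suc j)" if "ereal z \<le> x m" "m \<le> k" for m
        using that
      proof (induction m)
        case 0 then show ?case using x(1) by simp
      next
        case (Suc m)
        then show ?case by (cases "ereal z \<le> x m") (auto simp: less_Suc_eq)
      qed
      from this[of k] show ?thesis using x(2) by simp
    qed
    then obtain j where j: "j < k" "x j < ereal z" "ereal z \<le> x (Suc j)" by auto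
    have "J \<subseteq> einterval (x j) (x (Suc j))"
    proof
      fix w assume w: "w \<in> J"
      have 1: "x j < ereal w"
      proof (rule ccontr)
        assume "\<not> x j < ereal w"
        then have "ereal w \<le> x j" by simp
        then obtain f where f: "x j = ereal f" using j(2) by (cases "x j") auto
        then have "f \<in> J" using J(1) w z \<open>ereal w \<le> x j\<close> j(2) unfolding is_interval_1
          by (metis ereal_less_eq(3) less_ereal.simps(1) less_imp_le)
        then show False using inF[OF f] j J(2) by auto
      qed
      have 2: "ereal w < x (Suc j)"
      proof (rule ccontr)
        assume "\<not> ereal w < x (Suc j)"
        then have le: "x (Suc j) \<le> ereal w" by simp
        then obtain f where f: "x (Suc j) = ereal f" using j(3) by (cases "x (Suc j)") auto
        then have "f \<in> J" using J(1) w z le j(3) unfolding is_interval_1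
          by (metis ereal_less_eq(3))
        then show False using inF[OF f] j J(2) by auto
      qed
      show "w \<in> einterval (x j) (x (Suc j))" using 1 2 by (simp add: einterval_def)
    qed
    then show ?thesis using m[OF j(1)] by (blast intro: monotone_on_subset)
  qed
  then have "piecewise_monotone_off F t" by (simp add: piecewise_monotone_off_def F_def)
  then show thesis using card by (rule that)
qed

lemma step_density_cuts:
  assumes f: "f \<in> step_densities D"
  obtains F where "finite F" "card F \<le> D + 1"
    "\<forall>x y. x \<le> y \<longrightarrow> {x..y} \<inter> F = {} \<longrightarrow> f x = f y"
proof -
  obtain b a :: "nat \<Rightarrow> real" where
    f: "f = (\<lambda>y. \<Sum>j=1..D. a j * indicator {b j<..b (Suc j)} y)"
    using f unfolding step_densities_def by auto
  define F where "F = b ` {1..Suc D}"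
  have "card F \<le> card {1..Suc D}" unfolding F_def by (rule card_image_le) simp
  then have card: "card F \<le> D + 1" by simp
  have eq: "f x = f y" if xy: "x \<le> y" "{x..y} \<inter> F = {}" for x y
    unfolding f
  proof (intro sum.cong refl arg_cong2[where f="(*)"])
    fix j assume j: "j \<in> {1..D}"
    have "b j \<in> F" "b (Suc j) \<in> F" using j by (auto simp: F_def)
    then have "b j \<notin> {x..y}" "b (Suc j) \<notin> {x..y}" using xy by auto
    then show "indicator {b j<..b (Suc j)} x = (indicator {b j<..b (Suc j)} y :: real)"
      using xy(1) by (auto simp: indicator_def)
  qed
  have "finite F" by (simp add: F_def)
  then show thesis using card eq by (intro that[of F] allI impI)
qed

text \<open>Here the step structure of \<open>f\<close> matters: between its breakpoints only
  \<open>t\<close> varies, and \<open>rho_phi_mono\<close> applies. The count is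
  \<open>(k - 1) + (D + 1)\<close>.\<close>

lemma rho_phi_piecewise_monotone:
  assumes t: "t \<in> piecewise_monotone_densities k" and f: "f \<in> step_densities D" and k: "1 \<le> k"
  obtains F where "piecewise_monotone_off F (\<lambda>x. rho_phi (f x) (t x))" "card F \<le> k + D"
proof -
  obtain F where F: "piecewise_monotone_off F t" "card F \<le> k - 1"
    by (rule piecewise_monotone_density_cuts[OF t])
  obtain G where G: "finite G" "card G \<le> D + 1"
    "\<forall>x y. x \<le> y \<longrightarrow> {x..y} \<inter> G = {} \<longrightarrow> f x = f y"
    by (rule step_density_cuts[OF f])
  have nn: "0 \<le> t x" "0 \<le> f x" for x
  proof -
    have "t \<in> densities" using t by (simp add: piecewise_monotone_densities_def)
    then show "0 \<le> t x" by (rule densitiesD)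
    have "f \<in> densities" using f unfolding step_densities_def by blast
    then show "0 \<le> f x" by (rule densitiesD)
  qed
  have mono: "mono_on J (\<lambda>x. rho_phi (f x) (t x)) \<or> antimono_on J (\<lambda>x. rho_phi (f x) (t x))"
    if J: "is_interval J" "J \<inter> (F \<union> G) = {}" for J
  proof -
    have const: "f x = f y" if "x \<in> J" "y \<in> J" "x \<le> y" for x y
    proof (rule G(3)[rule_format, OF that(3)])
      have "{x..y} \<subseteq> J"
      proof
        fix z assume "z \<in> {x..y}"
        then show "z \<in> J" using J(1)[unfolded is_interval_1, rule_format, OF that(1,2), of z] by simp
      qed
      then show "{x..y} \<inter> G = {}" using J(2) by blast
    qed
    have "J \<inter> F = {}" using J(2) by blast
    then have "mono_on J t \<or> antimono_on J t" by (rule piecewise_monotone_offD(2)[OF F(1) J(1)])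
    then show ?thesis
    proof
      assume "mono_on J t"
      then have "mono_on J (\<lambda>x. rho_phi (f x) (t x))"
      proof (intro mono_onI)
        fix x y assume xy: "x \<in> J" "y \<in> J" "x \<le> y"
        then have "t x \<le> t y" by (rule mono_onD[OF \<open>mono_on J t\<close>])
        then show "rho_phi (f x) (t x) \<le> rho_phi (f y) (t y)"
          unfolding const[OF xy] by (intro rho_phi_mono nn)
      qed
      then show ?thesis ..
    next
      assume "antimono_on J t"
      then have "antimono_on J (\<lambda>x. rho_phi (f x) (t x))"
      proof (intro monotone_onI)
        fix x y assume xy: "x \<in> J" "y \<in> J" "x \<le> y"
        then have "t y \<le> t x" by (rule monotone_onD[OF \<open>antimono_on J t\<close>])
        then show "rho_phi (f y) (t y) \<le> rho_phi (f x) (t x)"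
          unfolding const[OF xy] by (intro rho_phi_mono nn)
      qed
      then show ?thesis ..
    qed
  qed
  have "finite (F \<union> G)" using piecewise_monotone_offD(1)[OF F(1)] G(1) by simp
  then have "piecewise_monotone_off (F \<union> G) (\<lambda>x. rho_phi (f x) (t x))"
    using mono by (rule piecewise_monotone_offI)
  moreover have "card (F \<union> G) \<le> k + D" using card_Un_le[of F G] F(2) G(2) k by linarith
  ultimately show thesis by (rule that)
qed

section \<open>Approximation by the countable dense subset\<close>

lemma sqrt_sum_squares_dist_le:
  fixes a b c :: real
  shows "\<bar>sqrt (a\<^sup>2 + b\<^sup>2) - sqrt (c\<^sup>2 + b\<^sup>2)\<bar> \<le> \<bar>a - c\<bar>"
  using norm_triangle_ineq3[of "Complex a b" "Complex c b"] by (simp add: cmod_def)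

text \<open>The bound is uniform in \<open>b\<close>, as required when the second density ranges
  over everything. It degenerates as \<open>a\<close> tends to 0, which reflects the discontinuity
  at zeros of the first density.\<close>

lemma rho_phi_diff_le:
  assumes a: "0 < a" and c: "0 \<le> c" and b: "0 \<le> b"
  shows "\<bar>rho_phi c b - rho_phi a b\<bar> \<le> 2 * \<bar>sqrt c - sqrt a\<bar> / sqrt a"
proof -
  define A C B where "A = sqrt a" and "C = sqrt c" and "B = sqrt b"
  define N N' where "N = sqrt (A\<^sup>2 + B\<^sup>2)" and "N' = sqrt (C\<^sup>2 + B\<^sup>2)"
  have nn: "0 < A" "0 \<le> C" "0 \<le> B" using assms by (auto simp: A_def B_def C_def)
  have NA: "A \<le> N" unfolding N_def by (rule real_le_rsqrt) simp
  have N0: "0 < N" using NA nn by simp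
  have phi: "rho_phi a b = (B - A) / N" "rho_phi c b = (B - C) / N'"
    using assms by (simp_all add: rho_phi_def A_def B_def C_def N_def N'_def)
  have dN: "\<bar>N - N'\<bar> \<le> \<bar>A - C\<bar>" unfolding N_def N'_def by (rule sqrt_sum_squares_dist_le)
  have main: "\<bar>rho_phi c b - rho_phi a b\<bar> \<le> 2 * (\<bar>A - C\<bar> / N)"
  proof (cases "N' = 0")
    case True
    then have "C\<^sup>2 + B\<^sup>2 = 0" by (simp add: N'_def)
    then have "C = 0" "B = 0" by (auto simp: sum_power2_eq_zero_iff)
    then show ?thesis using N0 nn by (simp add: phi divide_right_mono)
  next
    case False
    then have N'0: "0 < N'" by (simp add: N'_def less_le)
    have bc: "\<bar>B - C\<bar> / N' \<le> 1"
    proof -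
      have "B \<le> N'" "C \<le> N'" unfolding N'_def by (rule real_le_rsqrt; simp)+
      then show ?thesis using nn N'0 by (simp add: divide_le_eq)
    qed
    have "rho_phi c b - rho_phi a b = (A - C) / N + (B - C) / N' * ((N - N') / N)"
      unfolding phi using N0 N'0 by (simp add: field_simps)
    also have "\<bar>\<dots>\<bar> \<le> \<bar>A - C\<bar> / N + \<bar>B - C\<bar> / N' * (\<bar>N - N'\<bar> / N)"
      using N0 N'0 by (intro order_trans[OF abs_triangle_ineq]) (simp add: abs_mult abs_divide)
    also have "\<dots> \<le> \<bar>A - C\<bar> / N + 1 * (\<bar>A - C\<bar> / N)"
      using bc dN N0 N'0 by (intro add_left_mono mult_mono divide_right_mono) auto
    finally show ?thesis by simp
  qed
  also have "\<dots> \<le> 2 * (\<bar>A - C\<bar> / A)" using NA nn by (intro mult_left_mono divide_left_mono) auto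
  finally show ?thesis by (simp add: A_def C_def abs_minus_commute)
qed

text \<open>Young's inequality with a free parameter takes the place of Cauchy-Schwarz for
  integrals: after integration, a parameter above the Hellinger distance makes both terms of its
  order.\<close>

lemma rho_gap_diff_le:
  assumes nn: "0 \<le> a" "0 \<le> b" "0 \<le> c" and e: "0 < \<eta>"
  shows "rho_gap c b - rho_gap a b \<le> \<eta> * (3 * a + 3 * c + 12 * b) + (sqrt c - sqrt a)\<^sup>2 / (4 * \<eta>)"
proof -
  define A C B where "A = sqrt a" and "C = sqrt c" and "B = sqrt b"
  have n: "0 \<le> A" "0 \<le> C" "0 \<le> B" using nn by (auto simp: A_def B_def C_def)
  have sq: "a = A\<^sup>2" "b = B\<^sup>2" "c = C\<^sup>2" using nn by (auto simp: A_def B_def C_def)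
  define R R' where "R = sqrt ((a + b) / 2)" and "R' = sqrt ((c + b) / 2)"
  have R: "R = sqrt (A\<^sup>2 + B\<^sup>2) / sqrt 2" "R' = sqrt (C\<^sup>2 + B\<^sup>2) / sqrt 2"
    by (simp_all add: R_def R'_def sq real_sqrt_divide)
  have "\<bar>R' - R\<bar> = \<bar>sqrt (C\<^sup>2 + B\<^sup>2) - sqrt (A\<^sup>2 + B\<^sup>2)\<bar> / sqrt 2"
    by (simp add: R diff_divide_distrib[symmetric] abs_divide)
  also have "\<dots> \<le> \<bar>sqrt (C\<^sup>2 + B\<^sup>2) - sqrt (A\<^sup>2 + B\<^sup>2)\<bar> / 1"
    by (intro divide_left_mono) auto
  also have "\<dots> \<le> \<bar>C - A\<bar>" using sqrt_sum_squares_dist_le by simp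
  finally have dR: "\<bar>R' - R\<bar> \<le> \<bar>C - A\<bar>" .
  have RAB: "0 \<le> R" "R \<le> A + B"
  proof -
    show "0 \<le> R" using nn by (simp add: R_def)
    show "R \<le> A + B" unfolding R_def
    proof (rule real_le_lsqrt)
      show "(a + b) / 2 \<le> (A + B)\<^sup>2" using n by (simp add: sq power2_sum)
    qed (use n nn in auto)
  qed
  define w where "w = A + C + 2 * B"
  have "rho_gap c b - rho_gap a b = (A - C) * R + (B - C) * (R' - R)"
    by (simp add: rho_gap_def A_def B_def C_def R_def R'_def algebra_simps)
  also have "\<dots> \<le> \<bar>(A - C) * R\<bar> + \<bar>(B - C) * (R' - R)\<bar>" by linarith
  also have "\<dots> \<le> \<bar>A - C\<bar> * (A + B) + (B + C) * \<bar>C - A\<bar>"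
    unfolding abs_mult using RAB dR n by (intro add_mono mult_mono) auto
  also have "\<dots> = \<bar>C - A\<bar> * w" by (simp add: w_def abs_minus_commute algebra_simps)
  also have "\<dots> \<le> \<eta> * w\<^sup>2 + (C - A)\<^sup>2 / (4 * \<eta>)"
  proof -
    have "0 \<le> (2 * \<eta> * w - \<bar>C - A\<bar>)\<^sup>2 / (4 * \<eta>)" using e by simp
    also have "\<dots> = \<eta> * w\<^sup>2 + (C - A)\<^sup>2 / (4 * \<eta>) - \<bar>C - A\<bar> * w"
      using e by (simp add: power2_diff power_mult_distrib field_simps) (simp add: power2_eq_square)
    finally show ?thesis by simp
  qed
  also have "\<eta> * w\<^sup>2 \<le> \<eta> * (3 * a + 3 * c + 12 * b)"
  proof (rule mult_left_mono)
    \<comment> \<open>These three squares are exactly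
      \<open>3 * (A^2 + C^2 + (2 * B)^2) - w^2\<close>.\<close>
    have "0 \<le> (A - C)\<^sup>2 + (A - 2 * B)\<^sup>2 + (C - 2 * B)\<^sup>2" by simp
    then show "w\<^sup>2 \<le> 3 * a + 3 * c + 12 * b" unfolding w_def sq by (simp add: power2_eq_square algebra_simps)
  qed (use e in simp)
  finally show ?thesis by (simp add: A_def C_def)
qed

lemma rho_gap_integral_diff_le:
  assumes t: "t \<in> densities" and t': "t' \<in> densities" and u: "u \<in> densities" and e: "0 < \<eta>"
    and h: "hellinger t t' \<le> \<eta>"
  shows "(\<integral>x. rho_gap (t' x) (u x) \<partial>lborel) \<le> (\<integral>x. rho_gap (t x) (u x) \<partial>lborel) + 19 * \<eta>"
proof -
  note i = rho_gap_integrable[OF t u] rho_gap_integrable[OF t' u] hellinger_integrable[OF t' t]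
    densitiesD(3)[OF t] densitiesD(3)[OF t'] densitiesD(3)[OF u]
  have "(\<integral>x. rho_gap (t' x) (u x) - rho_gap (t x) (u x) \<partial>lborel)
    \<le> (\<integral>x. \<eta> * (3 * t x + 3 * t' x + 12 * u x) + (sqrt (t' x) - sqrt (t x))\<^sup>2 / (4 * \<eta>) \<partial>lborel)"
    using i by (intro integral_mono rho_gap_diff_le densitiesD(2) t t' u e) auto
  \<comment> \<open>18 = 3 + 3 + 12 since each density has mass 1; the squared difference of roots
    integrates to twice the squared distance.\<close>
  also have "\<dots> = 18 * \<eta> + (hellinger t' t)\<^sup>2 / (2 * \<eta>)"
    using i densitiesD(4)[OF t] densitiesD(4)[OF t'] densitiesD(4)[OF u]
    by (simp add: hellinger_sq)
  also have "(hellinger t' t)\<^sup>2 / (2 * \<eta>) \<le> \<eta>\<^sup>2 / (2 * \<eta>)"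
    using h hellinger_nonneg e by (intro divide_right_mono power_mono) (auto simp: hellinger_commute)
  also have "\<dots> \<le> \<eta>" using e by (simp add: power2_eq_square)
  finally show ?thesis using i by simp
qed

lemma AE_sample_components:
  assumes s: "s \<in> densities" and P: "AE x in lborel. P x"
  shows "AE X in sample_measure n s. \<forall>i\<in>{1..n}. P (X i)"
proof -
  have "AE x in law s. P x"
    using P densitiesD(1)[OF s] by (subst AE_density) auto
  then have "AE X in sample_measure n s. P (X i)" if "i \<in> {1..n}" for i
    unfolding sample_measure_def using that by (intro AE_PiM_component prob_space_law s)
  then show ?thesis by (intro AE_finite_allI) auto
qed

text \<open>Hellinger convergence is L1 convergence of the squared differences of roots, so a
  subsequence converges almost everywhere. This is needed because T evaluates densities at the
  observations.\<close>

lemma hellinger_closure_AE_limit: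
  assumes t: "t \<in> hellinger_closure S" and S: "S \<subseteq> densities"
  obtains u where "\<And>j. u j \<in> S" "(\<lambda>j. hellinger t (u j)) \<longlonglongrightarrow> 0"
    "AE x in lborel. (\<lambda>j. sqrt (u j x)) \<longlonglongrightarrow> sqrt (t x)"
proof -
  have td: "t \<in> densities" using t by (simp add: hellinger_closure_def)
  have "\<exists>v\<in>S. hellinger t v < inverse (real (Suc j))" for j
    using t by (simp add: hellinger_closure_def)
  then obtain v where v: "\<And>j. v j \<in> S" "\<And>j. hellinger t (v j) < inverse (real (Suc j))" by metis
  have vd: "v j \<in> densities" for j using v(1) S by blast
  have h0: "(\<lambda>j. hellinger t (v j)) \<longlonglongrightarrow> 0"
    by (rule tendsto_sandwich[OF _ _ tendsto_const LIMSEQ_inverse_real_of_nat])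
      (auto intro!: always_eventually hellinger_nonneg less_imp_le[OF v(2)] simp del: of_nat_Suc)
  have "(\<lambda>j. 2 * (hellinger t (v j))\<^sup>2) \<longlonglongrightarrow> 2 * 0\<^sup>2" by (intro tendsto_intros h0)
  then have "(\<lambda>j. \<integral>x. norm ((sqrt (t x) - sqrt (v j x))\<^sup>2) \<partial>lborel) \<longlonglongrightarrow> 0"
    by (simp add: hellinger_sq)
  from tendsto_L1_AE_subseq[OF hellinger_integrable[OF td vd] this]
  obtain r where r: "strict_mono r" "AE x in lborel. (\<lambda>j. (sqrt (t x) - sqrt (v (r j) x))\<^sup>2) \<longlonglongrightarrow> 0" by blast
  have "AE x in lborel. (\<lambda>j. sqrt (v (r j) x)) \<longlonglongrightarrow> sqrt (t x)"
    using r(2)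
  proof eventually_elim
    case (elim x)
    then have "(\<lambda>j. sqrt ((sqrt (t x) - sqrt (v (r j) x))\<^sup>2)) \<longlonglongrightarrow> sqrt 0"
      by (rule tendsto_real_sqrt)
    then have "(\<lambda>j. \<bar>sqrt (t x) - sqrt (v (r j) x)\<bar>) \<longlonglongrightarrow> 0" by simp
    then have "(\<lambda>j. sqrt (t x) - sqrt (v (r j) x)) \<longlonglongrightarrow> 0" by (rule tendsto_rabs_zero_cancel)
    then have "(\<lambda>j. sqrt (t x) - (sqrt (t x) - sqrt (v (r j) x))) \<longlonglongrightarrow> sqrt (t x) - 0"
      by (intro tendsto_intros)
    then show ?case by simp
  qed
  moreover have "(\<lambda>j. hellinger t (v (r j))) \<longlonglongrightarrow> 0"
    using LIMSEQ_subseq_LIMSEQ[OF h0 r(1)] by (simp add: o_def)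
  ultimately show thesis using v(1) by (intro that[of "\<lambda>j. v (r j)"])
qed

text \<open>\<open>T\<close> is not continuous in its first argument where that density vanishes, so sample points in the
  zero set of \<open>t\<close> are paid for separately; there are few of them by \<open>mass_zero_set_le\<close>.\<close>
lemma rho_T_approximation:
  assumes s: "s \<in> densities" and t: "t \<in> hellinger_closure S" and S: "S \<subseteq> densities"
  shows "AE X in sample_measure n s. \<forall>e>0. \<exists>t0\<in>S. \<forall>u\<in>densities.
     rho_T n X t0 u \<le> rho_T n X t u + sqrt 2 * sample_count n {x. t x = 0} X + e"
proof -
  have td: "t \<in> densities" using t by (simp add: hellinger_closure_def)
  obtain v where v: "\<And>j. v j \<in> S" "(\<lambda>j. hellinger t (v j)) \<longlonglongrightarrow> 0"
    "AE x in lborel. (\<lambda>j. sqrt (v j x)) \<longlonglongrightarrow> sqrt (t x)"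
    by (rule hellinger_closure_AE_limit[OF t S]) blast
  have vd: "v j \<in> densities" for j using v(1) S by blast
  from AE_sample_components[OF s v(3)]
  have "AE X in sample_measure n s. \<forall>i\<in>{1..n}. (\<lambda>j. sqrt (v j (X i))) \<longlonglongrightarrow> sqrt (t (X i))" .
  then show ?thesis
  proof eventually_elim
    case (elim X)
    show ?case
    proof (intro allI impI)
      fix e :: real assume e: "0 < e"
      \<comment> \<open>A bound on the error that does not involve \<open>u\<close>. The summand
        \<open>inverse (Suc j)\<close> keeps the Young parameter positive when the distance is 0.
        Where \<open>t (X i) = 0\<close> the quotient is 0 by convention, and that observation is
        charged to the count instead.\<close>
      define E where "E = (\<lambda>j. n / 2 * (19 * (hellinger t (v j) + inverse (Suc j)))
        + (\<Sum>i=1..n. 2 * \<bar>sqrt (v j (X i)) - sqrt (t (X i))\<bar> / sqrt (t (X i))) / sqrt 2)"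
      have summand: "(\<lambda>j. 2 * \<bar>sqrt (v j (X i)) - sqrt (t (X i))\<bar> / sqrt (t (X i)))
          \<longlonglongrightarrow> 2 * \<bar>sqrt (t (X i)) - sqrt (t (X i))\<bar> / sqrt (t (X i))" if i: "i \<in> {1..n}" for i
      proof -
        have lim: "(\<lambda>j. sqrt (v j (X i))) \<longlonglongrightarrow> sqrt (t (X i))" using elim i by blast
        show ?thesis unfolding divide_inverse
          by (intro tendsto_mult tendsto_const tendsto_rabs tendsto_diff lim)
      qed
      have "(\<lambda>j. \<Sum>i=1..n. 2 * \<bar>sqrt (v j (X i)) - sqrt (t (X i))\<bar> / sqrt (t (X i)))
          \<longlonglongrightarrow> (\<Sum>i=1..n. 2 * \<bar>sqrt (t (X i)) - sqrt (t (X i))\<bar> / sqrt (t (X i)))"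
        by (intro tendsto_sum summand)
      then have "E \<longlonglongrightarrow> n / 2 * (19 * (0 + 0)) + (\<Sum>i=1..n. 2 * \<bar>sqrt (t (X i)) - sqrt (t (X i))\<bar> / sqrt (t (X i))) / sqrt 2"
        unfolding E_def
        by (intro tendsto_add tendsto_mult tendsto_const v(2) LIMSEQ_inverse_real_of_nat tendsto_divide) auto
      then have "E \<longlonglongrightarrow> 0" by simp
      then have "\<forall>\<^sub>F j in sequentially. E j < e" using e by (rule order_tendstoD)
      then obtain j where j: "E j < e" by (auto simp: eventually_sequentially)
      show "\<exists>t0\<in>S. \<forall>u\<in>densities.
          rho_T n X t0 u \<le> rho_T n X t u + sqrt 2 * sample_count n {x. t x = 0} X + e"
      proof (intro bexI[of _ "v j"] ballI v(1))
        fix u assume u: "u \<in> densities"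
        have gap: "(\<integral>x. rho_gap (v j x) (u x) \<partial>lborel)
            \<le> (\<integral>x. rho_gap (t x) (u x) \<partial>lborel) + 19 * (hellinger t (v j) + inverse (Suc j))"
          by (intro rho_gap_integral_diff_le td vd u) (auto simp: hellinger_nonneg add_nonneg_pos)
        have gap': "n / 2 * (\<integral>x. rho_gap (v j x) (u x) \<partial>lborel)
            \<le> n / 2 * (\<integral>x. rho_gap (t x) (u x) \<partial>lborel) + n / 2 * (19 * (hellinger t (v j) + inverse (Suc j)))"
          unfolding distrib_left[symmetric] by (rule mult_left_mono[OF gap]) simp
        \<comment> \<open>At a zero of \<open>t\<close> two values in [-1, 1] differ by at most 2;
          after division by \<open>sqrt 2\<close> this is the factor \<open>sqrt 2\<close> of the
          count.\<close>
        have pt: "rho_phi (v j (X i)) (u (X i)) \<le> rho_phi (t (X i)) (u (X i))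
            + 2 * indicator {x. t x = 0} (X i) + 2 * \<bar>sqrt (v j (X i)) - sqrt (t (X i))\<bar> / sqrt (t (X i))" for i
        proof (cases "t (X i) = 0")
          case True
          have "\<bar>rho_phi (v j (X i)) (u (X i))\<bar> \<le> 1" "\<bar>rho_phi (t (X i)) (u (X i))\<bar> \<le> 1"
            by (intro abs_rho_phi_le_1 densitiesD(2) td vd u)+
          then show ?thesis using True by simp
        next
          case False
          then have "0 < t (X i)" using densitiesD(2)[OF td] by (simp add: less_le)
          from rho_phi_diff_le[OF this densitiesD(2)[OF vd] densitiesD(2)[OF u], of j "X i" "X i"] False
          show ?thesis by simp
        qed
        have "(\<Sum>i=1..n. rho_phi (v j (X i)) (u (X i))) / sqrt 2
          \<le> (\<Sum>i=1..n. rho_phi (t (X i)) (u (X i))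
            + 2 * indicator {x. t x = 0} (X i) + 2 * \<bar>sqrt (v j (X i)) - sqrt (t (X i))\<bar> / sqrt (t (X i))) / sqrt 2"
          by (intro divide_right_mono sum_mono pt) simp
        also have "\<dots> = (\<Sum>i=1..n. rho_phi (t (X i)) (u (X i))) / sqrt 2
            + (2 / sqrt 2) * sample_count n {x. t x = 0} X
            + (\<Sum>i=1..n. 2 * \<bar>sqrt (v j (X i)) - sqrt (t (X i))\<bar> / sqrt (t (X i))) / sqrt 2"
          unfolding sum.distrib add_divide_distrib sum_distrib_left[symmetric] by simp
        also have "2 / sqrt 2 = sqrt 2" by (simp add: real_div_sqrt)
        finally have "rho_T n X (v j) u \<le> rho_T n X t u + sqrt 2 * sample_count n {x. t x = 0} X + E j"
          unfolding rho_T_eq[OF vd u] rho_T_eq[OF td u] E_def using gap' by linarith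
        then show "rho_T n X (v j) u \<le> rho_T n X t u + sqrt 2 * sample_count n {x. t x = 0} X + e"
          using j by linarith
      qed
    qed
  qed
qed

section \<open>The risk bound\<close>

text \<open>A crude bound, whose purpose is to make the suprema and infima in the criterion those of
  bounded sets.\<close>

lemma abs_rho_T_le:
  assumes t: "t \<in> densities" and u: "u \<in> densities"
  shows "\<bar>rho_T n X t u\<bar> \<le> 2 * n"
proof -
  have h: "(hellinger t (\<lambda>x. (t x + u x) / 2))\<^sup>2 \<le> 1" "(hellinger u (\<lambda>x. (t x + u x) / 2))\<^sup>2 \<le> 1"
    using t u by (intro hellinger_sq_le_1 mean_density; simp)+
  have "\<bar>\<integral>x. rho_gap (t x) (u x) \<partial>lborel\<bar> \<le> 1"
    unfolding hellinger_gap[OF t u, symmetric] using h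
      zero_le_power2[of "hellinger t (\<lambda>x. (t x + u x) / 2)"]
      zero_le_power2[of "hellinger u (\<lambda>x. (t x + u x) / 2)"] by linarith
  then have 1: "\<bar>n / 2 * (\<integral>x. rho_gap (t x) (u x) \<partial>lborel)\<bar> \<le> n / 2 * 1"
    unfolding abs_mult by (intro mult_mono) auto
  have "\<bar>\<Sum>i=1..n. rho_phi (t (X i)) (u (X i))\<bar> \<le> (\<Sum>i=1..n. \<bar>rho_phi (t (X i)) (u (X i))\<bar>)"
    by (rule sum_abs)
  also have "\<dots> \<le> (\<Sum>i=1..n. 1)" by (intro sum_mono abs_rho_phi_le_1 densitiesD(2) t u)
  finally have "\<bar>\<Sum>i=1..n. rho_phi (t (X i)) (u (X i))\<bar> \<le> n" by simp
  then have "\<bar>(\<Sum>i=1..n. rho_phi (t (X i)) (u (X i))) / sqrt 2\<bar> \<le> n / 1"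
    unfolding abs_divide by (intro frac_le) auto
  then show ?thesis unfolding rho_T_eq[OF t u] using 1 by linarith
qed

text \<open>Chain: \<open>- T(t,v)\<close> is replaced by \<open>- T(t0,v) = T(v,t0)\<close>,
  bounded by the criterion at \<open>v\<close>, hence by that at \<open>t0\<close> plus 35.7, and
  then by \<open>B\<close> after returning to \<open>t\<close>. The passage between \<open>t\<close>
  and \<open>t0\<close> occurs twice, so \<open>c\<close> is doubled and 35.7 + 2/10 is at most
  36.\<close>

lemma near_minimizer_bound:
  assumes S: "S \<subseteq> densities" and t: "t \<in> densities" and v: "v \<in> rho_near_minimizers n X S"
    and approx: "\<And>e. 0 < e \<Longrightarrow> \<exists>t0\<in>S. \<forall>u\<in>densities. rho_T n X t0 u \<le> rho_T n X t u + c + e"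
    and B: "\<And>u. u \<in> S \<Longrightarrow> rho_T n X t u \<le> B"
  shows "- rho_T n X t v \<le> B + 2 * c + 36"
proof -
  have vS: "v \<in> S" and vY: "rho_Upsilon n X S v \<le> (INF t'\<in>S. rho_Upsilon n X S t') + 35.7"
    using v by (auto simp: rho_near_minimizers_def)
  obtain t0 where t0: "t0 \<in> S" "\<And>u. u \<in> densities \<Longrightarrow> rho_T n X t0 u \<le> rho_T n X t u + c + 1/10"
    using approx[of "1/10"] by auto
  have Tb: "\<bar>rho_T n X a b\<bar> \<le> 2 * n" if "a \<in> S" "b \<in> S" for a b
    using abs_rho_T_le that S by blast
  have bdd: "bdd_above ((\<lambda>b. rho_T n X a b) ` S)" if "a \<in> S" for a
  proof (rule bdd_aboveI2)
    fix b assume "b \<in> S"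
    then show "rho_T n X a b \<le> 2 * n" using Tb[OF that, of b] by linarith
  qed
  have upper: "rho_T n X a b \<le> rho_Upsilon n X S a" if "a \<in> S" "b \<in> S" for a b
    unfolding rho_Upsilon_def by (rule cSUP_upper[OF that(2) bdd[OF that(1)]])
  have bdd_Y: "bdd_below (rho_Upsilon n X S ` S)"
  proof (rule bdd_belowI2)
    fix a assume "a \<in> S"
    then show "- (2 * n) \<le> rho_Upsilon n X S a" using upper[of a v] Tb[of a v] vS by linarith
  qed
  have "- rho_T n X t v - c - 1/10 \<le> - rho_T n X t0 v" using t0(2)[of v] vS S by auto
  also have "\<dots> = rho_T n X v t0" by (rule rho_T_swap[symmetric]) (use t0(1) vS S in auto)
  also have "\<dots> \<le> rho_Upsilon n X S v" by (rule upper[OF vS t0(1)])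
  also note vY
  also have "(INF t'\<in>S. rho_Upsilon n X S t') \<le> rho_Upsilon n X S t0"
    by (rule cINF_lower[OF bdd_Y t0(1)])
  also have "rho_Upsilon n X S t0 \<le> B + c + 1/10"
    unfolding rho_Upsilon_def
  proof (rule cSUP_least)
    show "S \<noteq> {}" using vS by auto
    fix u assume "u \<in> S"
    then show "rho_T n X t0 u \<le> B + c + 1/10" using t0(2)[of u] B[of u] S by fastforce
  qed
  finally show ?thesis by simp
qed

section \<open>Choice of the numerical parameters\<close>

lemma log_plus_ge: "1 \<le> log_plus x" "ln x \<le> log_plus x"
  by (simp_all add: log_plus_def)

text \<open>With \<open>x = m / n\<close> the number of subsets is at most
  \<open>exp m * (n / m) ^ (2 * d + 2)\<close>, hence at most \<open>exp (7 * m * l)\<close>. The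
  exponent 9 leaves \<open>exp (- 2 * m * l)\<close>, which is below \<open>m / n\<close>. The
  condition on \<open>d\<close> fits \<open>d = 2 * m + 1\<close>, where it says
  \<open>m >= 2\<close>.\<close>

lemma small_subsets_exp_bound:
  fixes n m d :: nat and l :: real
  defines "l \<equiv> log_plus (n / m)"
  assumes m: "2 \<le> m" "m \<le> n" and d: "2 * d + 2 \<le> 6 * m"
  shows "card {D. D \<subseteq> {..<n} \<and> card D \<le> 2 * d + 2} * (2 * exp (- (9 * m * l))) \<le> 2 * (m / n)"
proof -
  define N where "N = real (card {D. D \<subseteq> {..<n} \<and> card D \<le> 2 * d + 2})"
  define x where "x = real m / n"
  have x: "0 < x" "x \<le> 1" using m by (auto simp: x_def)
  have lx: "ln (1 / x) \<le> l" "1 \<le> l" using log_plus_ge[of "real n / m"] by (auto simp: l_def x_def)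
  have lx0: "0 \<le> ln (1 / x)" using x by simp
  have "N * x ^ (2 * d + 2) \<le> (1 + x) ^ n" unfolding N_def by (rule card_small_subsets_le[OF x])
  also have "\<dots> \<le> exp x ^ n" using x by (intro power_mono) auto
  also have "\<dots> = exp m" using m by (simp add: exp_of_nat_mult[symmetric] x_def)
  finally have "N \<le> exp m * (1 / x) ^ (2 * d + 2)" using x by (simp add: field_simps)
  also have "(1 / x) ^ (2 * d + 2) = exp ((2 * d + 2) * ln (1 / x))"
    using x by (subst exp_of_nat_mult) simp
  also have "\<dots> \<le> exp (6 * m * l)"
  proof -
    have "real (2 * d + 2) * ln (1 / x) \<le> real (6 * m) * l"
      using d lx lx0 by (intro mult_mono) linarith+
    then show ?thesis by simp
  qed
  also have "exp m * exp (6 * m * l) \<le> exp (7 * m * l)"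
  proof -
    have "real m * 1 \<le> m * l" using lx by (intro mult_left_mono) auto
    then show ?thesis by (simp add: exp_add[symmetric] mult.commute)
  qed
  finally have N: "N \<le> exp (7 * m * l)" by simp
  have "N * (2 * exp (- (9 * m * l))) \<le> exp (7 * m * l) * (2 * exp (- (9 * m * l)))"
    by (rule mult_right_mono[OF N]) simp
  also have "\<dots> = 2 * exp (- (2 * m * l))" by (simp add: exp_add[symmetric])
  also have "\<dots> \<le> 2 * exp (- ln (1 / x))"
  proof -
    have "1 * l \<le> (2 * m) * l" using m lx by (intro mult_right_mono) auto
    then have "ln (1 / x) \<le> 2 * m * l" using lx by linarith
    then show ?thesis by simp
  qed
  also have "\<dots> = 2 * (m / n)" using m by (simp add: exp_minus x_def)
  finally show ?thesis by (simp add: N_def)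
qed

text \<open>\<open>M\<close> is \<open>n / m\<close> rounded up: fine enough for a discretisation
  error \<open>n / M\<close> of order \<open>m\<close>, and coarse enough for the harmonic sum to be
  of order \<open>log (n / m)\<close>.\<close>

lemma layer_number:
  fixes n m :: nat
  assumes m: "1 \<le> m" "m \<le> n"
  obtains M where "1 \<le> M" "n / M \<le> m" "harm M \<le> 3 * log_plus (n / m)"
proof -
  define M where "M = nat \<lceil>real n / m\<rceil>"
  have r1: "1 \<le> real n / m" using m by simp
  then have M: "real n / m \<le> M" "M \<le> real n / m + 1" unfolding M_def by linarith+
  have M1: "1 \<le> M" using M(1) r1 by linarith
  have 1: "n / M \<le> m" using M(1) M1 m by (simp add: field_simps)
  have "harm M \<le> 1 + ln (real M)" by (rule harm_le_ln[OF M1])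
  also have "ln (real M) \<le> ln (2 * (real n / m))" using M r1 M1 by (subst ln_le_cancel_iff) auto
  also have "ln (2 * (real n / m)) = ln 2 + ln (real n / m)" using r1 by (intro ln_mult_pos) auto
  also have "ln 2 \<le> (1::real)" using ln_le_minus_one[of 2] by simp
  finally have "harm M \<le> 3 * log_plus (n / m)" using log_plus_ge[of "real n / m"] by linarith
  with M1 1 that show thesis by blast
qed

lemma rho_T_uniform_bound:
  fixes n m :: nat and l :: real
  defines "l \<equiv> log_plus (n / m)"
  assumes s: "s \<in> densities" and t: "t \<in> densities" and u: "u \<in> densities"
    and m: "1 \<le> m" "m \<le> n"
    and dev: "\<And>c A. 0 < c \<Longrightarrow> A = {x. c \<le> rho_phi (t x) (u x)} \<or> A = {x. c \<le> - rho_phi (t x) (u x)} \<Longrightarrow>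
        \<bar>sample_count n A X - n * measure (law s) A\<bar>
          \<le> 2 * sqrt (n * measure (law s) A * (9 * m * l)) + 5 * (9 * m * l)"
  shows "rho_T n X t u \<le> 1.81 * n * (hellinger s t)\<^sup>2 - 0.19 * n * (hellinger s u)\<^sup>2 + 3348 * m * l\<^sup>2"
proof -
  define g where "g x = rho_phi (t x) (u x)" for x
  have g[measurable]: "g \<in> borel_measurable borel"
    unfolding g_def using densitiesD(1)[OF t] densitiesD(1)[OF u] by (rule measurable_rho_phi)
  have l1: "1 \<le> l" unfolding l_def by (rule log_plus_ge)
  obtain M where M: "1 \<le> M" "n / M \<le> m" "harm M \<le> 3 * l"
    unfolding l_def by (rule layer_number[OF m])
  define y where "y = 9 * m * l"
  have y0: "0 \<le> y" using l1 by (simp add: y_def)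
  have my: "m \<le> y" unfolding y_def using mult_left_mono[OF l1, of "real m"] by simp
  \<comment> \<open>The value 1/60 times the variance constant 6 is 1/10. It lowers the coefficient
    0.29, a lower bound for \<open>1 - 1 / sqrt 2\<close>, to 0.19 and raises 1.71 to 1.81.\<close>
  have dv1: "\<bar>(\<Sum>i=1..n. g (X i)) - n * (\<integral>x. g x \<partial>law s)\<bar>
      \<le> 2 * (n / M + 5 * y + y / (1/60) * harm M) + (1/60) * n * (\<integral>x. (g x)\<^sup>2 \<partial>law s)"
  proof (rule layered_deviation_signed[OF s g _ M(1) y0])
    show "\<bar>g x\<bar> \<le> 1" for x unfolding g_def by (intro abs_rho_phi_le_1 densitiesD(2) t u)
  qed (use dev in \<open>auto simp: g_def y_def\<close>)
  have "(\<integral>x. (g x)\<^sup>2 \<partial>law s) = (\<integral>x. s x * (g x)\<^sup>2 \<partial>lborel)"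
    by (rule integral_law[OF s]) measurable
  also have "\<dots> \<le> 6 * ((hellinger s t)\<^sup>2 + (hellinger s u)\<^sup>2)"
    unfolding g_def by (rule rho_variance_le[OF s t u])
  finally have "(1/60) * n * (\<integral>x. (g x)\<^sup>2 \<partial>law s) \<le> (1/60) * n * (6 * ((hellinger s t)\<^sup>2 + (hellinger s u)\<^sup>2))"
    by (rule mult_left_mono) simp
  moreover have "n / M + 5 * y + y / (1/60) * harm M \<le> y * l + 5 * (y * l) + y * 60 * (3 * l)"
  proof (intro add_mono)
    have yl: "y * 1 \<le> y * l" by (rule mult_left_mono[OF l1 y0])
    show "n / M \<le> y * l" using M(2) my yl by linarith
    show "5 * y \<le> 5 * (y * l)" using yl by simp
    show "y / (1/60) * harm M \<le> y * 60 * (3 * l)"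
      using M(3) y0 by (simp add: mult_left_mono mult.assoc)
  qed
  \<comment> \<open>1674 = 9 * (1 + 5 + 180); it is doubled to 3348 by the two signs.\<close>
  moreover have "y * l + 5 * (y * l) + y * 60 * (3 * l) = 1674 * m * l\<^sup>2"
    by (simp add: y_def power2_eq_square)
  ultimately have dv: "\<bar>(\<Sum>i=1..n. g (X i)) - n * (\<integral>x. g x \<partial>law s)\<bar>
      \<le> 3348 * m * l\<^sup>2 + n / 10 * ((hellinger s t)\<^sup>2 + (hellinger s u)\<^sup>2)"
    using dv1 by (simp add: algebra_simps)
  have eg: "(\<integral>x. g x \<partial>law s) = (\<integral>x. s x * rho_phi (t x) (u x) \<partial>lborel)"
    unfolding g_def[symmetric] by (rule integral_law[OF s g])
  define q where "q = 1 / sqrt (2::real)"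
  have q: "q \<le> 0.71" "0 \<le> q"
  proof -
    have "1 / 0.71 \<le> sqrt (2::real)" by (rule real_le_rsqrt) (simp add: power2_eq_square)
    then show "q \<le> 0.71" by (simp add: q_def field_simps)
  qed (simp add: q_def)
  define a b where "a = n * (hellinger s t)\<^sup>2" and "b = n * (hellinger s u)\<^sup>2"
  have ab: "0 \<le> a" "0 \<le> b" by (auto simp: a_def b_def)
  define G E Z where "G = (\<integral>x. rho_gap (t x) (u x) \<partial>lborel)"
    and "E = (\<integral>x. s x * rho_phi (t x) (u x) \<partial>lborel)" and "Z = (\<Sum>i=1..n. g (X i))"
  have "n * (G / 2 + E * q) \<le> n * ((1 + q) * (hellinger s t)\<^sup>2 - (1 - q) * (hellinger s u)\<^sup>2)"
    using rho_expectation_le[OF s t u] unfolding G_def E_def q_def by (intro mult_left_mono) auto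
  then have ex: "n / 2 * G + n * E * q \<le> (1 + q) * a - (1 - q) * b"
    by (simp add: a_def b_def algebra_simps)
  have "(Z - n * E) * q \<le> \<bar>Z - n * E\<bar> * 1"
    using q by (intro mult_mono) auto
  also have "\<dots> \<le> 3348 * m * l\<^sup>2 + (a + b) / 10"
    using dv unfolding eg by (simp add: Z_def E_def a_def b_def algebra_simps add_divide_distrib)
  finally have "n / 2 * G + Z * q \<le> (1 + q) * a - (1 - q) * b + (3348 * m * l\<^sup>2 + (a + b) / 10)"
    using ex by (simp add: algebra_simps)
  moreover have "(1 + q) * a \<le> 1.71 * a" using q ab by (intro mult_right_mono) auto
  moreover have "(1 - q) * b \<ge> 0.29 * b" using q ab by (intro mult_right_mono) auto
  ultimately have "n / 2 * G + Z * q \<le> 1.71 * a - 0.29 * b + (3348 * m * l\<^sup>2 + (a + b) / 10)" by linarith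
  also have "\<dots> = 1.81 * a - 0.19 * b + 3348 * m * l\<^sup>2" by (simp add: field_simps)
  finally show ?thesis unfolding rho_T_eq[OF t u]
    by (simp add: G_def Z_def g_def q_def a_def b_def mult.assoc)
qed

lemma (in prob_space) expectation_le_on_event:
  fixes f :: "'a \<Rightarrow> real"
  assumes f: "\<And>x. x \<in> space M \<Longrightarrow> f x \<le> 1" and B: "0 \<le> B" and Om: "Om \<in> sets M"
    and AE: "AE x in M. x \<in> Om \<longrightarrow> f x \<le> B" and q: "prob (space M - Om) \<le> q"
  shows "expectation f \<le> B + q"
proof (cases "integrable M f")
  case False
  \<comment> \<open>The Bochner integral of a non-integrable function is 0, so nonnegativity of
    \<open>B + q\<close> suffices.\<close>
  have "0 \<le> q" using q measure_nonneg order_trans by blast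
  then show ?thesis using False B by (simp add: not_integrable_integral_eq)
next
  case True
  have i: "integrable M (\<lambda>x. indicator (space M - Om) x :: real)"
    using Om by (intro integrable_real_indicator) (auto simp: emeasure_eq_measure)
  have "expectation f \<le> expectation (\<lambda>x. B + indicator (space M - Om) x)"
  proof (rule integral_mono_AE[OF True])
    show "integrable M (\<lambda>x. B + indicator (space M - Om) x)" using i by simp
    show "AE x in M. f x \<le> B + indicator (space M - Om) x"
      using AE AE_space
    proof eventually_elim
      case (elim x)
      then show ?case using f[of x] B by (auto simp: indicator_def)
    qed
  qed
  also have "\<dots> = B + prob (space M - Om)"
    using i Om by (subst Bochner_Integration.integral_add) (auto simp: prob_space)
  finally show ?thesis using q by simp
qed

text \<open>The infimum of an empty set of reals would be unspecified. The witness is the uniform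
  density on \<open>(0, D]\<close>, cut into \<open>D\<close> unit steps.\<close>

lemma step_densities_nonempty:
  assumes k: "2 \<le> k" and D: "1 \<le> D"
  shows "piecewise_monotone_densities k \<inter> step_densities D \<noteq> {}"
proof -
  define b a :: "nat \<Rightarrow> real" where "b j = real j - 1" and "a j = 1 / D" for j
  define f where "f = (\<lambda>y. \<Sum>j=1..D. a j * indicator {b j<..b (Suc j)} y)"
  have f_eq: "f y = indicator {0<..real D} y / D" for y
  proof -
    have "(\<Sum>j=1..E. indicator {b j<..b (Suc j)} y) = (indicator {0<..real E} y :: real)" for E
      by (induction E) (auto simp: b_def indicator_def)
    then show ?thesis by (simp add: f_def a_def sum_divide_distrib[symmetric])
  qed
  have "(\<integral>\<^sup>+x. ennreal (f x) \<partial>lborel) = (\<integral>\<^sup>+x. ennreal (1 / D) * indicator {0<..real D} x \<partial>lborel)"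
    by (intro nn_integral_cong) (auto simp: f_eq indicator_def)
  also have "\<dots> = ennreal (1 / D) * ennreal D" by (subst nn_integral_cmult_indicator) auto
  also have "\<dots> = 1" using D by (simp add: ennreal_mult[symmetric])
  finally have "(\<integral>\<^sup>+x. ennreal (f x) \<partial>lborel) = 1" .
  moreover have "f \<in> borel_measurable borel" unfolding f_eq[abs_def] by measurable
  moreover have "0 \<le> f x" for x by (simp add: f_eq)
  ultimately have fd: "f \<in> densities" by (simp add: densities_def)
  have "f \<in> step_densities D"
  proof -
    have "\<forall>j\<in>{1..D}. b j < b (Suc j) \<and> 0 \<le> a j" by (auto simp: a_def b_def)
    then show ?thesis using fd f_def unfolding step_densities_def by blast
  qed
  moreover have "f \<in> piecewise_monotone_densities k"
  proof -
    \<comment> \<open>The first breakpoint is \<open>D\<close> itself: the density increases on the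
      open interval before it and vanishes on all later ones.\<close>
    define x where "x j = (if j = 0 then - \<infinity> else if j = k then \<infinity> else ereal (real j * D))" for j
    have x: "x 0 = - \<infinity>" "x k = \<infinity>" "\<forall>j<k. x j < x (Suc j)" using k D by (auto simp: x_def)
    have "mono_on (einterval (x j) (x (Suc j))) f \<or> antimono_on (einterval (x j) (x (Suc j))) f" if j: "j < k" for j
    proof (cases "j = 0")
      case True
      have "mono_on (einterval (x j) (x (Suc j))) f"
        using k by (intro mono_onI) (auto simp: True x_def einterval_def f_eq indicator_def)
      then show ?thesis ..
    next
      case False
      have "antimono_on (einterval (x j) (x (Suc j))) f"
      proof (rule monotone_onI)
        fix u v assume uv: "u \<in> einterval (x j) (x (Suc j))" "v \<in> einterval (x j) (x (Suc j))"
        have "real D \<le> real j * D" using False mult_right_mono[of 1 "real j" "real D"] by simp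
        moreover have "real j * D < u" "real j * D < v" using uv False j by (auto simp: x_def einterval_def)
        ultimately have "real D < u" "real D < v" by linarith+
        then show "f v \<le> f u" by (simp add: f_eq)
      qed
      then show ?thesis ..
    qed
    then have "\<forall>I\<in>(\<lambda>j. einterval (x j) (x (Suc j))) ` {..<k}. mono_on I f \<or> antimono_on I f" by blast
    moreover have "(\<lambda>j. einterval (x j) (x (Suc j))) ` {..<k} \<in> interval_partitions k"
      unfolding interval_partitions_def using x by blast
    ultimately show ?thesis using fd unfolding piecewise_monotone_densities_def by blast
  qed
  ultimately show ?thesis by blast
qed

lemma rho_estimator_risk_bound:
  fixes n k D :: nat and l :: real
  defines "m \<equiv> k + D" and "l \<equiv> log_plus (n / (k + D))"
  assumes k: "2 \<le> k" and mn: "m \<le> n"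
    and est: "rho_estimator n (piecewise_monotone_densities k) shat" and s: "s \<in> densities"
    and t: "t \<in> piecewise_monotone_densities k" "t \<in> step_densities D"
  shows "(\<integral>X. (hellinger s (shat X))\<^sup>2 \<partial>sample_measure n s) \<le> 170 * (hellinger s t)\<^sup>2 + 74004 * (m / n * l ^ 3)"
proof -
  interpret M: prob_space "sample_measure n s" by (rule prob_space_sample[OF s])
  have m2: "2 \<le> m" using k by (simp add: m_def)
  have n0: "1 \<le> n" "1 \<le> m" using mn m2 by auto
  have l_eq: "l = log_plus (n / m)" by (simp add: l_def m_def)
  have l1: "1 \<le> l" unfolding l_def by (rule log_plus_ge)
  have pd: "u \<in> densities" if "u \<in> piecewise_monotone_densities k" for u
    using that by (simp add: piecewise_monotone_densities_def)
  note td = pd[OF t(1)]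
  obtain S where S: "S \<subseteq> piecewise_monotone_densities k" "piecewise_monotone_densities k \<subseteq> hellinger_closure S"
    and shat: "\<And>X. X \<in> space (sample_measure n s) \<Longrightarrow> shat X \<in> hellinger_closure (rho_near_minimizers n X S)"
    using est unfolding rho_estimator_def space_sample by blast
  have Sd: "S \<subseteq> densities" using S(1) pd by blast
  define y where "y = 9 * m * l"
  have ml: "m \<le> m * l" using mult_left_mono[OF l1, of "real m"] by simp
  have y0: "0 < y" using m2 l1 by (simp add: y_def)
  \<comment> \<open>At most \<open>m\<close> exceptional points for the function give at most
    \<open>2 * m + 1\<close> cuts for each of its level sets.\<close>
  have dy: "real (2 * m + 1) \<le> y" using ml m2 unfolding y_def by linarith
  obtain Om where Om: "Om \<in> sets (sample_measure n s)"
    and prob: "measure (sample_measure n s) (space (sample_measure n s) - Om)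
       \<le> card {D. D \<subseteq> {..<n} \<and> card D \<le> 2 * (2 * m + 1) + 2} * (2 * exp (- y))"
    and dev: "\<And>X A F. X \<in> Om \<Longrightarrow> A \<in> sets borel \<Longrightarrow> cuts F A \<Longrightarrow> card F \<le> 2 * m + 1 \<Longrightarrow>
       \<bar>sample_count n A X - n * measure (law s) A\<bar> \<le> 2 * sqrt (n * measure (law s) A * y) + 5 * y"
    by (rule uniform_count_bound[OF s n0(1) y0 dy]) blast
  have q: "measure (sample_measure n s) (space (sample_measure n s) - Om) \<le> 2 * (m / n)"
    using prob small_subsets_exp_bound[OF m2 mn, of "2 * m + 1"] m2 unfolding y_def l_eq by simp
  define H where "H = n * (hellinger s t)\<^sup>2"
  define L where "L = m * l\<^sup>2"
  have H0: "0 \<le> H" by (simp add: H_def)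
  have l12: "l \<le> l\<^sup>2" using mult_left_mono[OF l1, of l] l1 by (simp add: power2_eq_square)
  have mlL: "m * l \<le> L" unfolding L_def using l12 by (rule mult_left_mono) simp
  have L1: "1 \<le> L" using ml mlL n0(2) by linarith
  have T: "rho_T n X t u \<le> 1.81 * H - 0.19 * (n * (hellinger s u)\<^sup>2) + 3348 * L"
    if X: "X \<in> Om" and u: "u \<in> piecewise_monotone_densities k" for X u
  proof -
    obtain F where F: "piecewise_monotone_off F (\<lambda>x. rho_phi (t x) (u x))" "card F \<le> m"
      unfolding m_def by (rule rho_phi_piecewise_monotone[OF u t(2)]) (use k in auto)
    note [measurable] = densitiesD(1)[OF td] densitiesD(1)[OF pd[OF u]]
    have "rho_T n X t u \<le> 1.81 * n * (hellinger s t)\<^sup>2 - 0.19 * n * (hellinger s u)\<^sup>2 + 3348 * m * (log_plus (n / m))\<^sup>2"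
    proof (rule rho_T_uniform_bound[OF s td pd[OF u] n0(2) mn])
      fix c :: real and A assume c: "0 < c" and A: "A = {x. c \<le> rho_phi (t x) (u x)} \<or> A = {x. c \<le> - rho_phi (t x) (u x)}"
      have "\<exists>G. cuts G A \<and> card G \<le> 2 * m + 1"
        using A
      proof
        assume A: "A = {x. c \<le> rho_phi (t x) (u x)}"
        obtain G where "cuts G A" "card G \<le> 2 * card F + 1"
          unfolding A by (rule level_set_cuts[OF F(1)])
        then show ?thesis using F(2) by (intro exI[of _ G]) auto
      next
        assume A: "A = {x. c \<le> - rho_phi (t x) (u x)}"
        obtain G where "cuts G A" "card G \<le> 2 * card F + 1"
          unfolding A by (rule level_set_cuts[OF piecewise_monotone_off_uminus[OF F(1)]])
        then show ?thesis using F(2) by (intro exI[of _ G]) auto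
      qed
      then obtain G where G: "cuts G A" "card G \<le> 2 * m + 1" by blast
      have "A \<in> sets borel" using A by (elim disjE) (simp_all only:, measurable)
      from dev[OF X this G]
      show "\<bar>sample_count n A X - n * measure (law s) A\<bar>
          \<le> 2 * sqrt (n * measure (law s) A * (9 * m * log_plus (n / m))) + 5 * (9 * m * log_plus (n / m))"
        by (simp only: y_def l_eq)
    qed
    then show ?thesis by (simp only: H_def L_def l_eq mult.assoc)
  qed
  \<comment> \<open>By AM-GM the count is at most \<open>2 * n * P + 6 * y\<close>, where
    \<open>n * P <= 2 * H\<close> and \<open>y <= 9 * L\<close>.\<close>
  have N0: "sample_count n {x. t x = 0} X \<le> 4 * H + 54 * L" if X: "X \<in> Om" for X
  proof -
    note [measurable] = densitiesD(1)[OF td] densitiesD(1)[OF s]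
    let ?A = "{x. t x = 0}"
    obtain F where F: "finite F" "card F \<le> D + 1"
      "\<forall>x y. x \<le> y \<longrightarrow> {x..y} \<inter> F = {} \<longrightarrow> t x = t y"
      by (rule step_density_cuts[OF t(2)])
    have "cuts F ?A" unfolding cuts_def
    proof (intro conjI allI impI)
      fix x y :: real assume "x < y" "{x..y} \<inter> F = {}"
      then have "t x = t y" using F(3)[rule_format, of x y] by simp
      then show "x \<in> ?A \<longleftrightarrow> y \<in> ?A" by simp
    qed (rule F(1))
    moreover have A: "?A \<in> sets borel" by measurable
    moreover have "card F \<le> 2 * m + 1" using F(2) by (simp add: m_def)
    ultimately have "\<bar>sample_count n ?A X - n * measure (law s) ?A\<bar> \<le> 2 * sqrt (n * measure (law s) ?A * y) + 5 * y"
      by (intro dev[OF X])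
    moreover have "2 * sqrt (n * measure (law s) ?A * y) \<le> n * measure (law s) ?A + y"
      using arith_geo_mean_sqrt[of "n * measure (law s) ?A" y] y0 by simp
    moreover have "n * measure (law s) ?A \<le> 2 * H"
    proof -
      have "measure (law s) ?A = (\<integral>x. indicator ?A x \<partial>law s)" by simp
      also have "\<dots> = (\<integral>x. s x * indicator ?A x \<partial>lborel)" by (rule integral_law[OF s]) measurable
      also have "\<dots> \<le> 2 * (hellinger s t)\<^sup>2" by (rule mass_zero_set_le[OF s td])
      finally have "measure (law s) ?A \<le> 2 * (hellinger s t)\<^sup>2" .
      from mult_left_mono[OF this, of "real n"] show ?thesis by (simp add: H_def)
    qed
    moreover have "y \<le> 9 * L" using mlL by (simp add: y_def)
    ultimately show ?thesis by linarith
  qed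
  \<comment> \<open>170 = 2 * 85 and 74002 = 2 * 37000 + 2: the squared triangle inequality doubles
    both distances, and passing from the near minimizer to its limit costs at most
    \<open>m / n * l^2\<close>.\<close>
  define B where "B = 170 * (hellinger s t)\<^sup>2 + 74002 * (m / n * l\<^sup>2)"
  have near: "n * (hellinger s v)\<^sup>2 \<le> 85 * H + 37000 * L"
    if X: "X \<in> Om" and v: "v \<in> rho_near_minimizers n X S"
      and ap: "\<forall>e>0. \<exists>t0\<in>S. \<forall>u\<in>densities. rho_T n X t0 u \<le> rho_T n X t u + sqrt 2 * sample_count n {x. t x = 0} X + e"
    for X v
  proof -
    have vS: "v \<in> piecewise_monotone_densities k" using v S(1) by (auto simp: rho_near_minimizers_def)
    \<comment> \<open>For the criterion at \<open>t\<close> the negative distance term is dropped;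
      it is kept only at the near minimizer \<open>v\<close>, where it yields the risk.\<close>
    have up: "rho_T n X t u \<le> 1.81 * H + 3348 * L" if "u \<in> S" for u
    proof -
      have "0 \<le> 0.19 * (n * (hellinger s u)\<^sup>2)" by simp
      then show ?thesis using T[OF X, of u] S(1) that by (smt (verit) subsetD)
    qed
    have "- rho_T n X t v \<le> 1.81 * H + 3348 * L + 2 * (sqrt 2 * sample_count n {x. t x = 0} X) + 36"
      by (rule near_minimizer_bound[OF Sd td v]) (use ap up in blast)+
    moreover have "sqrt 2 * sample_count n {x. t x = 0} X \<le> 1.5 * (4 * H + 54 * L)"
    proof (rule mult_mono[OF _ N0[OF X]])
      show "sqrt 2 \<le> (1.5::real)" by (rule real_le_lsqrt) (simp_all add: power2_eq_square)
      show "0 \<le> sample_count n {x. t x = 0} X" by (intro sum_nonneg) simp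
    qed simp
    moreover note T[OF X vS]
    \<comment> \<open>Adding up gives \<open>0.19 * N <= 15.62 * H + 6894 * L\<close>, with 36
      absorbed by \<open>L >= 1\<close>; dividing by 0.19 and rounding up gives 85 and
      37000.\<close>
    moreover have "N \<le> 85 * H + 37000 * L"
      if "- z \<le> 1.81 * H + 3348 * L + 2 * w + 36" "w \<le> 1.5 * (4 * H + 54 * L)"
        "z \<le> 1.81 * H - 0.19 * N + 3348 * L" for z w N :: real
      using that H0 L1 by (simp add: field_simps)
    ultimately show ?thesis by blast
  qed
  have "AE X in sample_measure n s. X \<in> Om \<longrightarrow> (hellinger s (shat X))\<^sup>2 \<le> B"
    using rho_T_approximation[OF s subsetD[OF S(2) t(1)] Sd, of n] AE_space
  proof eventually_elim
    case (elim X)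
    show ?case
    proof
      assume X: "X \<in> Om"
      have e: "0 < real m / n" using n0 by simp
      have sd: "shat X \<in> densities" using shat[OF elim(2)] by (simp add: hellinger_closure_def)
      \<comment> \<open>The tolerance \<open>m / n\<close> is free because the closure allows any;
        its square is below the target rate since \<open>m <= n\<close>.\<close>
      obtain v where v: "v \<in> rho_near_minimizers n X S" "hellinger (shat X) v < real m / n"
        using shat[OF elim(2)] e by (auto simp: hellinger_closure_def)
      have vd: "v \<in> densities" using v(1) Sd by (auto simp: rho_near_minimizers_def)
      have "(hellinger v (shat X))\<^sup>2 \<le> (real m / n)\<^sup>2"
        using v(2) hellinger_nonneg by (intro power_mono) (auto simp: hellinger_commute)
      also have "\<dots> \<le> real m / n * 1"
        unfolding power2_eq_square using mn n0 by (intro mult_left_mono) auto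
      also have "\<dots> \<le> real m / n * l\<^sup>2"
        using l1 by (intro mult_left_mono) auto
      finally have 1: "(hellinger v (shat X))\<^sup>2 \<le> real m / n * l\<^sup>2" .
      have "(hellinger s v)\<^sup>2 \<le> (85 * H + 37000 * L) / n"
        using near[OF X v(1) elim(1)] n0 by (simp add: field_simps)
      also have "\<dots> = 85 * (hellinger s t)\<^sup>2 + 37000 * (real m / n * l\<^sup>2)"
        using n0 by (simp add: H_def L_def field_simps)
      finally have "(hellinger s v)\<^sup>2 \<le> 85 * (hellinger s t)\<^sup>2 + 37000 * (real m / n * l\<^sup>2)" .
      moreover have "a \<le> 170 * h + 74002 * r"
        if "a \<le> 2 * b + 2 * c" "b \<le> 85 * h + 37000 * r" "c \<le> r" for a b c h r :: real
        using that by linarith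
      ultimately show "(hellinger s (shat X))\<^sup>2 \<le> B"
        using hellinger_sq_triangle[OF s vd sd] 1 unfolding B_def by blast
    qed
  qed
  moreover have "(hellinger s (shat X))\<^sup>2 \<le> 1" if "X \<in> space (sample_measure n s)" for X
    using shat[OF that] by (intro hellinger_sq_le_1 s) (simp add: hellinger_closure_def)
  moreover have "0 \<le> B" by (simp add: B_def)
  ultimately have "(\<integral>X. (hellinger s (shat X))\<^sup>2 \<partial>sample_measure n s) \<le> B + 2 * (m / n)"
    using Om q by (intro M.expectation_le_on_event)
  \<comment> \<open>The exceptional event adds 2 to 74002; both \<open>l^2\<close> and
    \<open>l^0\<close> are then relaxed to \<open>l^3\<close>, as \<open>l >= 1\<close>.\<close>
  also have "\<dots> \<le> 170 * (hellinger s t)\<^sup>2 + 74004 * (m / n * l ^ 3)"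
  proof -
    have "real m / n * l\<^sup>2 \<le> real m / n * l ^ 3" "real m / n * l ^ 0 \<le> real m / n * l ^ 3"
      using l1 by (intro mult_left_mono power_increasing; simp)+
    moreover have "h + 74002 * p + 2 * r \<le> h + 74004 * w" if "p \<le> w" "r * 1 \<le> w" for h p r w :: real
      using that by linarith
    ultimately show ?thesis unfolding B_def power_0 by blast
  qed
  finally show ?thesis .
qed

theorem corollary2:
  shows "\<exists>C::real. 0 < C \<and> C \<le> 1 \<and>
    (\<forall>(n::nat) (k::nat) shat. n \<ge> 3 \<longrightarrow> k \<ge> 2 \<longrightarrow>
       rho_estimator n (piecewise_monotone_densities k) shat \<longrightarrow>
       (\<forall>s\<in>densities.
          C * (\<integral>X. (hellinger s (shat X))\<^sup>2 \<partial>sample_measure n s)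
          \<le> (INF D\<in>{1::nat..}.
               (INF sbar\<in>piecewise_monotone_densities k \<inter> step_densities D. (hellinger s sbar)\<^sup>2)
               + real (k + D) / real n * (log_plus (real n / real (k + D))) ^ 3)))"
proof (intro exI[of _ "1 / 100000"] conjI allI impI ballI)
  fix n k :: nat and shat and s :: "real \<Rightarrow> real"
  assume n: "3 \<le> n" and k: "2 \<le> k" and est: "rho_estimator n (piecewise_monotone_densities k) shat"
    and s: "s \<in> densities"
  define R where "R = (\<integral>X. (hellinger s (shat X))\<^sup>2 \<partial>sample_measure n s)"
  interpret M: prob_space "sample_measure n s" by (rule prob_space_sample[OF s])
  have R1: "R \<le> 1 + 0"
    unfolding R_def
  proof (rule M.expectation_le_on_event[where Om = "space (sample_measure n s)"])
    show "(hellinger s (shat X))\<^sup>2 \<le> 1" if "X \<in> space (sample_measure n s)" for X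
      using est that unfolding rho_estimator_def space_sample
      by (intro hellinger_sq_le_1 s) (auto simp: hellinger_closure_def)
    then show "AE X in sample_measure n s. X \<in> space (sample_measure n s) \<longrightarrow> (hellinger s (shat X))\<^sup>2 \<le> 1"
      by (intro AE_I2) simp
  qed auto
  show "1 / 100000 * R \<le> (INF D\<in>{1::nat..}.
               (INF sbar\<in>piecewise_monotone_densities k \<inter> step_densities D. (hellinger s sbar)\<^sup>2)
               + real (k + D) / real n * (log_plus (real n / real (k + D))) ^ 3)"
  proof (rule cINF_greatest)
    fix D :: nat assume "D \<in> {1..}"
    then have D: "1 \<le> D" by simp
    define P where "P = real (k + D) / real n * (log_plus (real n / real (k + D))) ^ 3"
    have l1: "1 \<le> log_plus (real n / real (k + D)) ^ 3" by (intro one_le_power log_plus_ge)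
    \<comment> \<open>\<open>P\<close> does not depend on the comparison density, so it is moved to
      the left to leave a plain infimum.\<close>
    have "1 / 100000 * R - P \<le> (INF sbar\<in>piecewise_monotone_densities k \<inter> step_densities D. (hellinger s sbar)\<^sup>2)"
    proof (rule cINF_greatest[OF step_densities_nonempty[OF k D]])
      fix t assume t: "t \<in> piecewise_monotone_densities k \<inter> step_densities D"
      have h0: "0 \<le> (hellinger s t)\<^sup>2" by simp
      show "1 / 100000 * R - P \<le> (hellinger s t)\<^sup>2"
      proof (cases "k + D \<le> n")
        case True
        \<comment> \<open>Both 170 and 74004 lie below the reciprocal of the chosen
          constant.\<close>
        have "R \<le> 170 * (hellinger s t)\<^sup>2 + 74004 * P"
          using rho_estimator_risk_bound[OF k True est s] t unfolding R_def P_def by auto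
        moreover have "0 \<le> P" unfolding P_def by (intro mult_nonneg_nonneg order_trans[OF zero_le_one l1]) simp
        ultimately show ?thesis using h0 by linarith
      next
        case False
        \<comment> \<open>Too many pieces for the sample size: the rate is already at least 1, which
          bounds any squared Hellinger distance.\<close>
        then have "1 \<le> real (k + D) / real n" using n by simp
        then have "1 * 1 \<le> P" unfolding P_def by (intro mult_mono l1) auto
        then show ?thesis using R1 h0 by linarith
      qed
    qed
    then show "1 / 100000 * R \<le> (INF sbar\<in>piecewise_monotone_densities k \<inter> step_densities D. (hellinger s sbar)\<^sup>2)
        + real (k + D) / real n * (log_plus (real n / real (k + D))) ^ 3"
      unfolding P_def by linarith
  qed simp
qed simp_all

end
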